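(* Consider the Constrained regime of the RCPB policy with arrival parameter $0<\lambda<1$, memory parameter $c(n)=c$ for an integer $c\ge1$, and idle-server message rate $\mu(n)=\alpha/(1-\lambda)$ with a constant $\alpha>0$, and let $\mathbb{E}[W]$ be the asymptotic delay, viewed as a function of $c$ with $\lambda$ and $\alpha$ held fixed. (i) If $\alpha<\lambda$, then $$\lim_{c\to\infty}\mathbb{E}[W]=\frac{\lambda(\lambda-\alpha)}{(1-\lambda)(\lambda-\alpha)+\alpha}.$$ (ii) If $\alpha=\lambda$, then $\mathbb{E}[W]=\dfrac{\lambda}{1-\lambda+c}\le\dfrac1c$ for every $c\ge 1$. (iii) If $\alpha>\lambda$, then $\mathbb{E}[W]=\lambda\left[1-\lambda+\frac{\alpha}{\lambda}+\cdots+\left(\frac{\alpha}{\lambda}\right)^c\right]^{-1}\le\left(\dfrac{\lambda}{\alpha}\right)^c$ for every $c\ge 1$.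
   Context: Model: for each $n\ge1$ there are $n$ parallel unit-rate servers, each with its own infinite-capacity FIFO queue (a job in service counts as being in queue); a server is idle iff its queue is empty. Jobs arrive as a Poisson process of rate $\lambda n$, with i.i.d. exponential mean-$1$ sizes independent of arrivals, and are dispatched immediately to a queue. Resource Constrained Pull-Based (RCPB) policy with parameters $c(n)\in\{1,\dots,n\}$ and $\mu(n)>0$: (a) the dispatcher stores up to $c(n)$ server IDs (tokens) in a virtual queue; (b) each idle server sends messages to the dispatcher as a Poisson process of rate $\mu(n)$; upon receipt the server's ID is added to the virtual queue unless it is already stored or the virtual queue is full, in which case the message is discarded; (c) an arriving job is sent, if there is at least one token, to the queue of a server whose ID is chosen uniformly at random among the stored tokens, and that token is deleted; if there are no tokens, it is sent to a uniformly random queue. (When $c(n)=c$ is constant, only $n\ge c$ is considered.) Let $Q^n_i(t)$ be the number of jobs in queue $i$, $M^n(t)$ the number of tokens. $(Q^n,M^n)$ is a positive recurrent continuous-time Markov chain on $\{(q,m)\in\mathbb{Z}_+^n\times\{0,\dots,c(n)\}:\ \sum_i\mathbf{1}_{\{q_i=0\}}\ge m\}$ with transition rates: $(q,0)\to(q+e_i,0)$ at rate $\lambda$; for $m>0$, $(q,m)\to(q+e_i,m-1)$ at rate $n\lambda\mathbf{1}_{\{q_i=0\}}/\sum_j\mathbf{1}_{\{q_j=0\}}$; $(q,m)\to(q-e_i,m)$ at rate $\mathbf{1}_{\{q_i>0\}}$; $(q,m)\to(q,m+1)$ at rate $\mu(n)(\sum_i\mathbf{1}_{\{q_i=0\}}-m)\mathbf{1}_{\{m<c(n)\}}$.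 $S^n_i$ is the fraction of queues with at least $i$ jobs. The queueing delay $\mathbb{E}[W^n]$ is the steady-state mean time that a job spends in queue until its service starts; by Little's law $\mathbb{E}[W^n]=\frac1\lambda\mathbb{E}\left[\sum_{i=1}^\infty S^n_i\right]-1$ (expectation under the stationary distribution). The asymptotic delay is $\mathbb{E}[W]=\limsup_{n\to\infty}\mathbb{E}[W^n]$ (for each fixed $c$). *)

theory Defs
  imports "HOL-Probability.Probability"
begin

section \<open>Continuous-time Markov chains with given transition rates\<close>

text \<open>A transition function \<open>P\<close> on the state space \<open>S\<close>: \<open>P t x\<close> is the law at time \<open>t\<close> of
  the chain started in \<open>x\<close>. Values for negative times or outside \<open>S\<close> are irrelevant.\<close>

definition transition_function :: "'s set \<Rightarrow> (real \<Rightarrow> 's \<Rightarrow> 's pmf) \<Rightarrow> bool" where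
  "transition_function S P \<longleftrightarrow>
     (\<forall>x\<in>S. P 0 x = return_pmf x) \<and>
     (\<forall>t\<ge>0. \<forall>x\<in>S. set_pmf (P t x) \<subseteq> S) \<and>
     (\<forall>s\<ge>0. \<forall>t\<ge>0. \<forall>x\<in>S. P (s + t) x = bind_pmf (P s x) (P t))"

text \<open>The chain jumps from \<open>x\<close> to \<open>y \<noteq> x\<close> at rate \<open>r x y\<close>; the diagonal of \<open>r\<close> is ignored. The
  second condition says that \<open>x\<close> is left at the total rate of the jumps out of \<open>x\<close>. If these
  total rates are bounded over \<open>S\<close>, as they are below, the rates determine \<open>P\<close> on \<open>S\<close>.\<close>

definition has_transition_rates ::
  "'s set \<Rightarrow> (real \<Rightarrow> 's \<Rightarrow> 's pmf) \<Rightarrow> ('s \<Rightarrow> 's \<Rightarrow> real) \<Rightarrow> bool" where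
  "has_transition_rates S P r \<longleftrightarrow>
     (\<forall>x\<in>S. \<forall>y\<in>S - {x}. ((\<lambda>t. pmf (P t x) y / t) \<longlongrightarrow> r x y) (at_right 0)) \<and>
     (\<forall>x\<in>S. ((\<lambda>t. (1 - pmf (P t x) x) / t) \<longlongrightarrow> (\<Sum>\<^sub>\<infinity>y\<in>S - {x}. r x y)) (at_right 0))"

definition stationary_distribution :: "'s set \<Rightarrow> ('s \<Rightarrow> 's \<Rightarrow> real) \<Rightarrow> 's pmf \<Rightarrow> bool" where
  "stationary_distribution S r \<pi> \<longleftrightarrow>
     set_pmf \<pi> \<subseteq> S \<and>
     (\<exists>P. transition_function S P \<and> has_transition_rates S P r \<and>
          (\<forall>t\<ge>0. bind_pmf \<pi> (P t) = \<pi>))"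


section \<open>The Resource Constrained Pull-Based policy\<close>

text \<open>A state is a pair of the list of the \<open>n\<close> queue lengths and the number of tokens. The
  servers are numbered from \<open>0\<close>.\<close>

type_synonym rcpb_state = "nat list \<times> nat"

definition idle_servers :: "nat list \<Rightarrow> nat" where
  "idle_servers q = card {i. i < length q \<and> q ! i = 0}"

definition rcpb_states :: "nat \<Rightarrow> nat \<Rightarrow> rcpb_state set" where
  "rcpb_states n c = {(q, m). length q = n \<and> m \<le> c \<and> m \<le> idle_servers q}"

text \<open>Arguments: arrival parameter \<open>lam\<close>, message rate \<open>\<mu>\<close>, number of servers \<open>n\<close>, memory \<open>c\<close>.
  The summands are: arrival without tokens, arrival with tokens, departure, new token.\<close>

definition rcpb_rate ::
  "real \<Rightarrow> real \<Rightarrow> nat \<Rightarrow> nat \<Rightarrow> rcpb_state \<Rightarrow> rcpb_state \<Rightarrow> real" where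
  "rcpb_rate lam \<mu> n c = (\<lambda>(q, m) y.
     (\<Sum>i<n. if m = 0 \<and> y = (q[i := q ! i + 1], 0) then lam else 0) +
     (\<Sum>i<n. if m > 0 \<and> y = (q[i := q ! i + 1], m - 1)
             then real n * lam * of_bool (q ! i = 0) / real (idle_servers q) else 0) +
     (\<Sum>i<n. if y = (q[i := q ! i - 1], m) then of_bool (q ! i > 0) else 0) +
     (if y = (q, m + 1) then \<mu> * (real (idle_servers q) - real m) * of_bool (m < c) else 0))"

definition rcpb_stationary :: "real \<Rightarrow> real \<Rightarrow> nat \<Rightarrow> nat \<Rightarrow> rcpb_state pmf \<Rightarrow> bool" where
  "rcpb_stationary lam \<mu> n c = stationary_distribution (rcpb_states n c) (rcpb_rate lam \<mu> n c)"

definition queue_fraction :: "nat list \<Rightarrow> nat \<Rightarrow> real" where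
  "queue_fraction q i = real (card {j. j < length q \<and> q ! j \<ge> i}) / real (length q)"

text \<open>The mean queueing delay as given by Little's law, for the stationary distribution \<open>\<pi>\<close>. The
  expectation is a nonnegative integral, so that an infinite mean would be the value \<open>\<infinity>\<close>. The
  series starts with the fraction of queues with at least \<open>1\<close> job.\<close>

definition mean_delay :: "real \<Rightarrow> rcpb_state pmf \<Rightarrow> ereal" where
  "mean_delay lam \<pi> =
     ereal (1 / lam) *
       enn2ereal (\<integral>\<^sup>+ (q, m). (\<Sum>i. ennreal (queue_fraction q (Suc i))) \<partial>measure_pmf \<pi>) - 1"

definition asymptotic_delay :: "real \<Rightarrow> (nat \<Rightarrow> rcpb_state pmf) \<Rightarrow> ereal" where
  "asymptotic_delay lam \<pi> = limsup (\<lambda>n. mean_delay lam (\<pi> n))"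

end

theory Submission imports Defs begin

text \<open>
  Write \<open>x\<close> for the mean queue length, \<open>b\<close> for the fraction of busy servers and \<open>m\<close> for the number
  of tokens. The token count jumps at rates of order \<open>n\<close>, while \<open>x\<close> and \<open>b\<close> move at rates of order
  one. If \<open>b\<close> were constantly \<open>lam\<close>, then \<open>m\<close> would be, up to errors of order \<open>1 / n\<close>, a birth-death
  chain with birth-to-death ratio \<open>\<alpha> / lam\<close>, so it would vanish with probability \<open>1 / D\<close>, where
  \<open>D = (\<Sum>k\<le>c. (\<alpha> / lam) ^ k)\<close>, independently of the slow variables. Stationarity means that the
  generator applied to any reasonable function has mean zero. For the sum of the squared queue
  lengths this says \<open>E x = lam + lam * E (x * of_bool (m = 0))\<close>, and the independence turns it into
  \<open>E x = lam + lam * E x / D\<close>. By Little's law the delay is \<open>E x / lam - 1\<close>, hence in the limit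
  \<open>lam / (D - lam)\<close>, and the three regimes of the theorem are three ways to evaluate \<open>D\<close>.

  Everything is derived from such mean-zero identities (\<open>expectation_generator\<close>), with explicit error
  terms. There are two points of substance.

  \<^item> Averaging (\<open>token_balance\<close>, \<open>token_averaging\<close>). The test function \<open>\<psi> q * of_bool (m \<le> k)\<close> gives
    the detailed balance equation of the token chain, weighted by \<open>\<psi>\<close>, for every slowly varying \<open>\<psi>\<close>.

  \<^item> Concentration of \<open>b\<close> at \<open>lam\<close> (\<open>busy_fraction_excess_le\<close>). In the fluid limit the fractions \<open>s j\<close>
    of queues with at least \<open>j\<close> jobs form a cooperative system, whose equilibrium is
    \<open>\<sigma> j = lam * (lam / D) ^ (j - 1)\<close>. For a cooperative system in which the total of the \<open>s j\<close> grows
    at rate \<open>lam - b\<close>, the sum of the positive parts of \<open>s j - \<sigma> j\<close> decreases at least at the rate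
    \<open>max 0 (b - lam)\<close>, so this rate has mean zero under any invariant law. As \<open>E b = lam\<close> exactly, the
    deviation \<open>\<bar>b - lam\<bar>\<close> has vanishing mean too. For finite \<open>n\<close> the positive part is smoothed at a
    scale \<open>\<delta>\<close> and the levels are cut at \<open>K\<close>; then \<open>n\<close> tends to infinity before \<open>\<delta>\<close> and \<open>K\<close> are
    removed.

  A cubic Foster function bounds the second moment of the queue lengths uniformly in \<open>n\<close>, which makes
  all test functions integrable and transfers the concentration of \<open>b\<close> to the weighted deviation
  \<open>x * \<bar>b - lam\<bar>\<close>.
\<close>

section \<open>Stationary expectations of the generator\<close>

lemma expectation_bind_pmf_bounded:
  fixes f :: "'b \<Rightarrow> real"
  assumes "\<And>x. \<bar>f x\<bar> \<le> B"
  shows "measure_pmf.expectation (bind_pmf p k) f =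
    measure_pmf.expectation p (\<lambda>x. measure_pmf.expectation (k x) f)"
  unfolding measure_pmf_bind
  by (rule integral_bind[where K = "count_space UNIV" and B = B and B' = 1])
     (use assms in \<open>auto simp: measure_pmf.emeasure_space_le_1 measure_subprob
        intro: measure_pmf.finite_measure\<close>)

lemma integrable_pmf_bounded:
  fixes f :: "'a \<Rightarrow> real"
  assumes "\<And>x. x \<in> set_pmf p \<Longrightarrow> \<bar>f x\<bar> \<le> B"
  shows "integrable (measure_pmf p) f"
  using assms by (intro measure_pmf.integrable_const_bound[where B = B]) (auto simp: AE_measure_pmf_iff)

lemma expectation_mono_pmf:
  fixes f g :: "'a \<Rightarrow> real"
  assumes "integrable (measure_pmf p) f" "integrable (measure_pmf p) g"
    and "\<And>x. x \<in> set_pmf p \<Longrightarrow> f x \<le> g x"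
  shows "measure_pmf.expectation p f \<le> measure_pmf.expectation p g"
  using assms by (intro integral_mono_AE) (auto simp: AE_measure_pmf_iff)

lemma return_probability_supermultiplicative:
  assumes P: "transition_function S P" and x: "x \<in> S" and "s \<ge> 0" "t \<ge> 0"
  shows "pmf (P s x) x * pmf (P t x) x \<le> pmf (P (s + t) x) x"
proof -
  have "P (s + t) x = bind_pmf (P s x) (P t)"
    using assms by (auto simp: transition_function_def)
  then have "pmf (P (s + t) x) x = measure_pmf.expectation (P s x) (\<lambda>y. pmf (P t y) x)"
    by (simp add: pmf_bind)
  also have "\<dots> \<ge> measure_pmf.expectation (P s x) (\<lambda>y. indicator {x} y * pmf (P t x) x)"
    by (intro expectation_mono_pmf integrable_pmf_bounded[where B = 1])
       (auto simp: indicator_def pmf_le_1)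
  finally show ?thesis by (simp add: measure_pmf_single)
qed

lemma return_probability_power:
  assumes "transition_function S P" "x \<in> S" "h \<ge> 0"
  shows "pmf (P h x) x ^ k \<le> pmf (P (real k * h) x) x"
proof (induction k)
  case 0
  then show ?case using assms by (simp add: transition_function_def)
next
  case (Suc k)
  have "pmf (P h x) x ^ Suc k \<le> pmf (P h x) x * pmf (P (real k * h) x) x"
    using Suc by (simp add: mult_left_mono)
  also have "\<dots> \<le> pmf (P (h + real k * h) x) x"
    using assms by (intro return_probability_supermultiplicative) auto
  finally show ?case by (simp add: algebra_simps)
qed

text \<open>The return probability \<open>P t x x\<close> is supermultiplicative in \<open>t\<close>, so by Bernoulli's inequality
  the difference quotient at \<open>t\<close> is at most the one at \<open>t / k\<close>, for every \<open>k\<close>. This makes the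
  difference quotients of the semigroup bounded uniformly in \<open>t\<close> and allows dominated convergence.\<close>
lemma exit_probability_le:
  assumes P: "transition_function S P" and x: "x \<in> S" and t: "t > 0"
    and q: "((\<lambda>t. (1 - pmf (P t x) x) / t) \<longlongrightarrow> q) (at_right 0)"
  shows "1 - pmf (P t x) x \<le> q * t"
proof -
  have "filterlim (\<lambda>k. t / real (Suc k)) (at_right 0) sequentially"
    unfolding filterlim_at using t
    by (auto simp: eventually_sequentially divide_inverse simp del: of_nat_Suc
        intro!: tendsto_mult_right_zero LIMSEQ_inverse_real_of_nat)
  from filterlim_compose[OF q this]
  have lim: "(\<lambda>k. (1 - pmf (P (t / real (Suc k)) x) x) / (t / real (Suc k))) \<longlonglongrightarrow> q" .
  have "(1 - pmf (P t x) x) / t \<le> (1 - pmf (P (t / real (Suc k)) x) x) / (t / real (Suc k))" for k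
  proof -
    let ?p = "pmf (P (t / real (Suc k)) x) x"
    have "1 + real (Suc k) * (?p - 1) \<le> ?p ^ Suc k"
      using Bernoulli_inequality[of "?p - 1" "Suc k"] by simp
    also have "\<dots> \<le> pmf (P (real (Suc k) * (t / real (Suc k))) x) x"
      using t by (intro return_probability_power[OF P x]) auto
    also have "real (Suc k) * (t / real (Suc k)) = t" by simp
    finally have "1 - pmf (P t x) x \<le> real (Suc k) * (1 - ?p)"
      by (simp add: algebra_simps del: of_nat_Suc)
    from divide_right_mono[OF this, of t] show ?thesis using t by (simp add: mult.commute)
  qed
  then have "(1 - pmf (P t x) x) / t \<le> q"
    by (intro LIMSEQ_le_const[OF lim]) auto
  then show ?thesis using t by (simp add: field_simps)
qed

text \<open>Only finitely many targets have a positive rate. The probability of all the other states is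
  \<open>o(t)\<close>, because the exit rate of \<open>x\<close> is the sum of the rates into these targets.\<close>
lemma difference_quotient_tendsto_generator:
  fixes f :: "'s \<Rightarrow> real"
  assumes rates: "has_transition_rates S P r" and P: "transition_function S P" and x: "x \<in> S"
    and fin: "finite A" and A: "\<And>y. y \<notin> A \<Longrightarrow> r x y = 0" "\<And>y. y \<notin> S \<Longrightarrow> r x y = 0"
    and B: "\<And>y. \<bar>f y\<bar> \<le> B"
  shows "((\<lambda>t. (measure_pmf.expectation (P t x) f - f x) / t) \<longlongrightarrow>
           (\<Sum>y\<in>A. r x y * (f y - f x))) (at_right 0)"
proof -
  define A' where "A' = A \<inter> S - {x}"
  have fin': "finite A'" and xA': "x \<notin> A'" using fin by (auto simp: A'_def)
  have jump: "((\<lambda>t. pmf (P t x) y / t) \<longlongrightarrow> r x y) (at_right 0)" if "y \<in> A'" for y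
    using rates x that by (auto simp: has_transition_rates_def A'_def)
  have "(\<Sum>\<^sub>\<infinity>y\<in>S - {x}. r x y) = (\<Sum>\<^sub>\<infinity>y\<in>A'. r x y)"
    using A by (intro infsum_cong_neutral) (auto simp: A'_def)
  also have "\<dots> = (\<Sum>y\<in>A'. r x y)" using fin' by simp
  finally have exit: "((\<lambda>t. (1 - pmf (P t x) x) / t) \<longlongrightarrow> (\<Sum>y\<in>A'. r x y)) (at_right 0)"
    using rates x unfolding has_transition_rates_def by metis
  define rest where "rest t = 1 - pmf (P t x) x - (\<Sum>y\<in>A'. pmf (P t x) y)" for t
  have rest_lim: "((\<lambda>t. 2 * B * (rest t / t)) \<longlongrightarrow> 0) (at_right 0)"
  proof -
    have "((\<lambda>t. 2 * B * ((1 - pmf (P t x) x) / t - (\<Sum>y\<in>A'. pmf (P t x) y / t))) \<longlongrightarrow>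
       2 * B * ((\<Sum>y\<in>A'. r x y) - (\<Sum>y\<in>A'. r x y))) (at_right 0)"
      by (intro tendsto_intros exit jump)
    then show ?thesis by (simp add: rest_def diff_divide_distrib sum_divide_distrib)
  qed
  have main_lim: "((\<lambda>t. \<Sum>y\<in>A'. pmf (P t x) y / t * (f y - f x)) \<longlongrightarrow>
      (\<Sum>y\<in>A'. r x y * (f y - f x))) (at_right 0)"
    by (intro tendsto_intros jump)
  have error: "\<bar>(measure_pmf.expectation (P t x) f - f x) / t -
      (\<Sum>y\<in>A'. pmf (P t x) y / t * (f y - f x))\<bar> \<le> 2 * B * (rest t / t)" if t: "t > 0" for t
  proof -
    let ?p = "measure_pmf (P t x)"
    let ?I = "insert x A'"
    have int: "integrable ?p (\<lambda>y. (f y - f x) * indicator C y)" for C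
      by (rule integrable_pmf_bounded[where B = "2 * B"])
         (use B[of x] B in \<open>auto simp: indicator_def abs_le_iff intro: order_trans; smt (verit)\<close>)
    have intf: "integrable ?p f" by (rule integrable_pmf_bounded) (rule B)
    have "measure_pmf.expectation (P t x) f - f x = (LINT y|?p. f y - f x)"
      using intf by simp
    also have "\<dots> = (LINT y|?p. (f y - f x) * indicator ?I y + (f y - f x) * indicator (- ?I) y)"
      by (intro Bochner_Integration.integral_cong) (auto simp: indicator_def)
    also have "\<dots> = (LINT y|?p. (f y - f x) * indicator ?I y) + (LINT y|?p. (f y - f x) * indicator (- ?I) y)"
      by (intro Bochner_Integration.integral_add int)
    also have "(LINT y|?p. (f y - f x) * indicator ?I y) = (\<Sum>y\<in>?I. pmf (P t x) y * (f y - f x))"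
      using fin' by (subst integral_measure_pmf[where A = ?I]) (auto simp: indicator_def intro!: sum.cong)
    also have "\<dots> = (\<Sum>y\<in>A'. pmf (P t x) y * (f y - f x))"
      using fin' xA' by simp
    finally have split: "measure_pmf.expectation (P t x) f - f x - (\<Sum>y\<in>A'. pmf (P t x) y * (f y - f x)) =
      (LINT y|?p. (f y - f x) * indicator (- ?I) y)" by simp
    have "\<bar>LINT y|?p. (f y - f x) * indicator (- ?I) y\<bar> \<le> (LINT y|?p. \<bar>(f y - f x) * indicator (- ?I) y\<bar>)"
      by (rule integral_abs_bound)
    also have "\<dots> \<le> (LINT y|?p. 2 * B * indicator (- ?I) y)"
    proof (intro expectation_mono_pmf integrable_abs int)
      show "integrable ?p (\<lambda>y. 2 * B * indicator (- ?I) y :: real)"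
        by (rule integrable_pmf_bounded[where B = "2 * \<bar>B\<bar>"]) (auto simp: indicator_def abs_mult)
      show "\<bar>(f y - f x) * indicator (- ?I) y\<bar> \<le> 2 * B * indicator (- ?I) y" for y
        using B[of x] B[of y] by (auto simp: indicator_def)
    qed
    also have "\<dots> = 2 * B * measure ?p (- ?I)" by simp
    also have "measure ?p (- ?I) = 1 - measure ?p ?I"
      using measure_pmf.prob_compl[of ?I "P t x"] by (simp add: Compl_eq_Diff_UNIV)
    also have "measure ?p ?I = (\<Sum>y\<in>?I. pmf (P t x) y)"
      using fin' by (simp add: measure_measure_pmf_finite)
    also have "1 - \<dots> = rest t" using fin' xA' by (simp add: rest_def)
    finally have "\<bar>measure_pmf.expectation (P t x) f - f x - (\<Sum>y\<in>A'. pmf (P t x) y * (f y - f x))\<bar>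
      \<le> 2 * B * rest t" using split by simp
    then have "\<bar>measure_pmf.expectation (P t x) f - f x - (\<Sum>y\<in>A'. pmf (P t x) y * (f y - f x))\<bar> / t
      \<le> 2 * B * rest t / t" using t by (intro divide_right_mono) auto
    moreover have "(measure_pmf.expectation (P t x) f - f x) / t - (\<Sum>y\<in>A'. pmf (P t x) y / t * (f y - f x))
      = (measure_pmf.expectation (P t x) f - f x - (\<Sum>y\<in>A'. pmf (P t x) y * (f y - f x))) / t"
      by (simp add: sum_divide_distrib diff_divide_distrib)
    ultimately show ?thesis using t by (simp add: abs_divide)
  qed
  have "((\<lambda>t. (measure_pmf.expectation (P t x) f - f x) / t -
      (\<Sum>y\<in>A'. pmf (P t x) y / t * (f y - f x))) \<longlongrightarrow> 0) (at_right 0)"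
    by (rule Lim_null_comparison[OF _ rest_lim])
       (use error in \<open>auto simp: eventually_at_filter intro!: always_eventually\<close>)
  from tendsto_add[OF this main_lim]
  have "((\<lambda>t. (measure_pmf.expectation (P t x) f - f x) / t) \<longlongrightarrow> (\<Sum>y\<in>A'. r x y * (f y - f x))) (at_right 0)"
    by simp
  also have "(\<Sum>y\<in>A'. r x y * (f y - f x)) = (\<Sum>y\<in>A. r x y * (f y - f x))"
    using fin A by (intro sum.mono_neutral_left) (auto simp: A'_def)
  finally show ?thesis .
qed

text \<open>\<open>A x\<close> is any finite set that contains the states to which the chain can jump from \<open>x\<close>; it
  may contain \<open>x\<close> itself, which contributes nothing to the generator. The uniform bound \<open>R\<close> on the
  total rates justifies exchanging the derivative at time zero with the stationary expectation.\<close>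
locale stationary_chain =
  fixes S :: "'s set" and r :: "'s \<Rightarrow> 's \<Rightarrow> real" and p :: "'s pmf"
    and A :: "'s \<Rightarrow> 's set" and R :: real
  assumes stationary: "stationary_distribution S r p"
    and finite_targets: "x \<in> S \<Longrightarrow> finite (A x)"
    and rate_outside_targets: "x \<in> S \<Longrightarrow> y \<notin> A x \<Longrightarrow> r x y = 0"
    and rate_outside_states: "x \<in> S \<Longrightarrow> y \<notin> S \<Longrightarrow> r x y = 0"
    and rate_nonneg: "x \<in> S \<Longrightarrow> r x y \<ge> 0"
    and total_rate_le: "x \<in> S \<Longrightarrow> (\<Sum>y\<in>A x. r x y) \<le> R"
begin

definition generator :: "('s \<Rightarrow> real) \<Rightarrow> 's \<Rightarrow> real" where
  "generator f x = (\<Sum>y\<in>A x. r x y * (f y - f x))"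

lemma set_pmf_stationary: "set_pmf p \<subseteq> S"
  using stationary by (simp add: stationary_distribution_def)

lemma total_rate_bound_nonneg: "R \<ge> 0"
proof -
  obtain x where "x \<in> S" using set_pmf_stationary set_pmf_not_empty[of p] by auto
  then show ?thesis using total_rate_le[of x] sum_nonneg[of "A x" "r x"] rate_nonneg by force
qed

lemma abs_generator_le:
  assumes x: "x \<in> S" and w: "\<And>y. y \<in> A x \<Longrightarrow> r x y \<noteq> 0 \<Longrightarrow> \<bar>f y - f x\<bar> \<le> w"
  shows "\<bar>generator f x\<bar> \<le> R * \<bar>w\<bar>"
proof -
  have "\<bar>generator f x\<bar> \<le> (\<Sum>y\<in>A x. \<bar>r x y * (f y - f x)\<bar>)"
    unfolding generator_def by (rule sum_abs)
  also have "\<dots> \<le> (\<Sum>y\<in>A x. r x y * \<bar>w\<bar>)"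
  proof (intro sum_mono)
    fix y assume "y \<in> A x"
    then show "\<bar>r x y * (f y - f x)\<bar> \<le> r x y * \<bar>w\<bar>"
      using w[of y] rate_nonneg[OF x, of y]
      by (cases "r x y = 0") (auto simp: abs_mult intro!: mult_left_mono)
  qed
  also have "\<dots> \<le> R * \<bar>w\<bar>"
    using total_rate_le[OF x] by (simp add: mult_right_mono flip: sum_distrib_right)
  finally show ?thesis .
qed

lemma expectation_generator_bounded:
  assumes B: "\<And>x. \<bar>f x\<bar> \<le> B"
  shows "measure_pmf.expectation p (generator f) = 0"
proof -
  obtain P where P: "transition_function S P" "has_transition_rates S P r"
    and inv: "\<And>t. t \<ge> 0 \<Longrightarrow> bind_pmf p (P t) = p"
    using stationary by (auto simp: stationary_distribution_def)
  define t where "t k = inverse (real (Suc k))" for k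
  have t_pos: "t k > 0" for k by (simp add: t_def)
  have t_lim: "filterlim t (at_right 0) sequentially"
    unfolding filterlim_at t_def using LIMSEQ_inverse_real_of_nat by simp
  define s where "s k x = (measure_pmf.expectation (P (t k) x) f - f x) / t k" for k x
  have intf: "integrable (measure_pmf q) f" for q by (rule integrable_pmf_bounded) (rule B)
  have B0: "B \<ge> 0" using B[of undefined] by linarith
  have E_bound: "\<bar>measure_pmf.expectation q f\<bar> \<le> B" for q
    using expectation_mono_pmf[of q f "\<lambda>_. B"] expectation_mono_pmf[of q "\<lambda>_. - B" f] intf B
    by (simp add: abs_le_iff minus_le_iff)
  have s_zero: "measure_pmf.expectation p (s k) = 0" for k
  proof -
    have "measure_pmf.expectation p (\<lambda>x. measure_pmf.expectation (P (t k) x) f) = measure_pmf.expectation p f"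
      using expectation_bind_pmf_bounded[of f B p "P (t k)"] B inv[of "t k"] t_pos[of k] by simp
    moreover have "integrable (measure_pmf p) (\<lambda>x. measure_pmf.expectation (P (t k) x) f)"
      by (rule integrable_pmf_bounded) (rule E_bound)
    ultimately show ?thesis using intf[of p] by (simp add: s_def[abs_def])
  qed
  have s_bound: "\<bar>s k x\<bar> \<le> 2 * B * R" if x: "x \<in> S" for k x
  proof -
    have "(\<Sum>\<^sub>\<infinity>y\<in>S - {x}. r x y) = (\<Sum>\<^sub>\<infinity>y\<in>A x - {x}. r x y)"
      using rate_outside_targets[OF x] rate_outside_states[OF x] by (intro infsum_cong_neutral) auto
    also have "\<dots> = (\<Sum>y\<in>A x - {x}. r x y)" using finite_targets[OF x] by simp
    also have "\<dots> \<le> (\<Sum>y\<in>A x. r x y)"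
      using finite_targets[OF x] rate_nonneg[OF x] by (intro sum_mono2) auto
    finally have "(\<Sum>\<^sub>\<infinity>y\<in>S - {x}. r x y) \<le> R" using total_rate_le[OF x] by linarith
    moreover have "1 - pmf (P (t k) x) x \<le> (\<Sum>\<^sub>\<infinity>y\<in>S - {x}. r x y) * t k"
      using P x by (intro exit_probability_le[OF P(1) x t_pos]) (auto simp: has_transition_rates_def)
    ultimately have leave: "1 - pmf (P (t k) x) x \<le> R * t k"
      using t_pos[of k] by (smt (verit) mult_right_mono)
    let ?q = "measure_pmf (P (t k) x)"
    have "measure_pmf.expectation (P (t k) x) f - f x = (LINT y|?q. f y - f x)"
      using intf by simp
    also have "\<bar>\<dots>\<bar> \<le> (LINT y|?q. \<bar>f y - f x\<bar>)" by (rule integral_abs_bound)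
    also have "\<dots> \<le> (LINT y|?q. 2 * B * indicator (- {x}) y)"
    proof (intro expectation_mono_pmf integrable_abs)
      show "integrable ?q (\<lambda>y. f y - f x)" using intf by simp
      show "integrable ?q (\<lambda>y. 2 * B * indicator (- {x}) y :: real)"
        by (rule integrable_pmf_bounded[where B = "2 * B"]) (use B0 in \<open>auto simp: indicator_def\<close>)
      show "\<bar>f y - f x\<bar> \<le> 2 * B * indicator (- {x}) y" for y
        using B[of x] B[of y] by (auto simp: indicator_def)
    qed
    also have "\<dots> = 2 * B * (1 - pmf (P (t k) x) x)"
      using measure_pmf.prob_compl[of "{x}" "P (t k) x"]
      by (simp add: Compl_eq_Diff_UNIV measure_pmf_single)
    also have "\<dots> \<le> 2 * B * (R * t k)"
      using leave B0 by (intro mult_left_mono) auto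
    finally show ?thesis using t_pos[of k] by (simp add: s_def field_simps)
  qed
  have "(\<lambda>k. measure_pmf.expectation p (s k)) \<longlonglongrightarrow> measure_pmf.expectation p (generator f)"
  proof (rule integral_dominated_convergence[where w = "\<lambda>_. 2 * B * R"])
    show "AE x in measure_pmf p. (\<lambda>k. s k x) \<longlonglongrightarrow> generator f x"
    proof (rule AE_pmfI)
      fix x assume "x \<in> set_pmf p"
      then have x: "x \<in> S" using set_pmf_stationary by auto
      have "((\<lambda>t. (measure_pmf.expectation (P t x) f - f x) / t) \<longlongrightarrow> generator f x) (at_right 0)"
        unfolding generator_def using x finite_targets rate_outside_targets rate_outside_states B
        by (intro difference_quotient_tendsto_generator[OF P(2) P(1), where B = B]) auto
      from filterlim_compose[OF this t_lim] show "(\<lambda>k. s k x) \<longlonglongrightarrow> generator f x"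
        by (simp add: s_def)
    qed
    show "AE x in measure_pmf p. norm (s k x) \<le> 2 * B * R" for k
      using s_bound set_pmf_stationary by (auto simp: AE_measure_pmf_iff)
  qed auto
  then have "(\<lambda>k. 0) \<longlonglongrightarrow> measure_pmf.expectation p (generator f)" by (simp add: s_zero)
  then show ?thesis by (simp add: LIMSEQ_const_iff)
qed

text \<open>For unbounded functions: truncation to \<open>[-k, k]\<close> does not increase any \<open>\<bar>f y - f x\<bar>\<close>, so \<open>w\<close>
  dominates the generators of all truncations.\<close>
lemma expectation_generator:
  assumes w: "integrable (measure_pmf p) w"
    and f: "\<And>x y. x \<in> S \<Longrightarrow> y \<in> A x \<Longrightarrow> r x y \<noteq> 0 \<Longrightarrow> \<bar>f y - f x\<bar> \<le> w x"
  shows "measure_pmf.expectation p (generator f) = 0" "integrable (measure_pmf p) (generator f)"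
proof -
  define g where "g k x = max (- real k) (min (real k) (f x))" for k x
  have bound: "\<bar>generator (g k) x\<bar> \<le> R * \<bar>w x\<bar>" if "x \<in> S" for k x
    using that f by (intro abs_generator_le) (force simp: g_def)+
  have zero: "measure_pmf.expectation p (generator (g k)) = 0" for k
    by (rule expectation_generator_bounded[where B = "real k"]) (auto simp: g_def)
  have "(\<lambda>k. measure_pmf.expectation p (generator (g k))) \<longlonglongrightarrow> measure_pmf.expectation p (generator f)"
  proof (rule integral_dominated_convergence[where w = "\<lambda>x. R * \<bar>w x\<bar>"])
    show "AE x in measure_pmf p. (\<lambda>k. generator (g k) x) \<longlonglongrightarrow> generator f x"
    proof (rule AE_pmfI)
      fix x
      have "(\<lambda>k. g k y) \<longlonglongrightarrow> f y" for y
      proof (rule tendsto_eventually)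
        obtain k0 where "\<bar>f y\<bar> \<le> real k0" using real_arch_simple by blast
        then have "g k y = f y" if "k \<ge> k0" for k
          using that by (auto simp: g_def)
        then show "\<forall>\<^sub>F k in sequentially. g k y = f y" by (auto simp: eventually_sequentially)
      qed
      then show "(\<lambda>k. generator (g k) x) \<longlonglongrightarrow> generator f x"
        unfolding generator_def by (intro tendsto_intros)
    qed
    show "AE x in measure_pmf p. norm (generator (g k) x) \<le> R * \<bar>w x\<bar>" for k
      using bound set_pmf_stationary by (auto simp: AE_measure_pmf_iff)
  qed (use w in auto)
  then show "measure_pmf.expectation p (generator f) = 0" by (simp add: zero LIMSEQ_const_iff)
  show "integrable (measure_pmf p) (generator f)"
  proof (rule Bochner_Integration.integrable_bound)
    show "integrable (measure_pmf p) (\<lambda>x. R * \<bar>w x\<bar>)" using w by auto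
    have "\<bar>generator f x\<bar> \<le> R * \<bar>w x\<bar>" if "x \<in> S" for x
      using that f by (intro abs_generator_le) auto
    then show "AE x in measure_pmf p. norm (generator f x) \<le> norm (R * \<bar>w x\<bar>)"
      using set_pmf_stationary total_rate_bound_nonneg by (auto simp: AE_measure_pmf_iff abs_mult)
  qed auto
qed

text \<open>Truncating \<open>f\<close> from above at \<open>k\<close> does not raise its drift where \<open>f x < k\<close>, and makes the drift
  nonpositive elsewhere. Hence \<open>g\<close> restricted to \<open>f x < k\<close> has mean at most \<open>C\<close>, and no
  integrability has to be known in advance.\<close>
lemma foster_bound:
  assumes f: "\<And>x. f x \<ge> 0" and g: "\<And>x. g x \<ge> 0" and C: "C \<ge> 0"
    and drift: "\<And>x. x \<in> S \<Longrightarrow> generator f x \<le> C - g x"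
  shows "integrable (measure_pmf p) g" "measure_pmf.expectation p g \<le> C"
proof -
  define F where "F k x = min (f x) (real k)" for k x
  define G where "G k x = g x * indicator {x. f x < real k} x" for k x
  have pt: "G k x \<le> C - generator (F k) x" if x: "x \<in> S" for k x
  proof (cases "f x < real k")
    case True
    have "generator (F k) x \<le> generator f x"
      unfolding generator_def using True rate_nonneg[OF x]
      by (intro sum_mono mult_left_mono) (auto simp: F_def)
    with drift[OF x] True show ?thesis by (simp add: G_def)
  next
    case False
    have "generator (F k) x \<le> 0"
      unfolding generator_def using False rate_nonneg[OF x]
      by (intro sum_nonpos mult_nonneg_nonpos) (auto simp: F_def)
    with C False show ?thesis by (simp add: G_def)
  qed
  have G0: "G k x \<ge> 0" for k x using g by (simp add: G_def)
  have Fb: "\<bar>F k x\<bar> \<le> real k" for k x using f by (simp add: F_def)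
  have genF: "\<bar>generator (F k) x\<bar> \<le> R * \<bar>2 * real k\<bar>" if "x \<in> S" for k x
    using that
  proof (rule abs_generator_le)
    show "\<bar>F k y - F k x\<bar> \<le> 2 * real k" for y using Fb[of k y] Fb[of k x] by linarith
  qed
  have intF: "integrable (measure_pmf p) (generator (F k))" for k
    using genF set_pmf_stationary by (intro integrable_pmf_bounded) blast
  have intG: "integrable (measure_pmf p) (G k)" for k
  proof (rule integrable_pmf_bounded)
    fix x assume "x \<in> set_pmf p"
    then have x: "x \<in> S" using set_pmf_stationary by auto
    show "\<bar>G k x\<bar> \<le> C + R * \<bar>2 * real k\<bar>" using pt[OF x, of k] genF[OF x, of k] G0[of k x] by linarith
  qed
  have "measure_pmf.expectation p (G k) \<le> measure_pmf.expectation p (\<lambda>x. C - generator (F k) x)" for k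
    using intF intG pt set_pmf_stationary by (intro expectation_mono_pmf) auto
  also have "measure_pmf.expectation p (\<lambda>x. C - generator (F k) x) = C" for k
    using intF expectation_generator_bounded[of "F k", OF Fb] by simp
  finally have EG: "measure_pmf.expectation p (G k) \<le> C" for k .
  have "(\<integral>\<^sup>+x. ennreal (g x) \<partial>p) = (\<integral>\<^sup>+x. (SUP k. ennreal (G k x)) \<partial>p)"
  proof (intro nn_integral_cong antisym)
    fix x
    obtain k where "f x < real k" using reals_Archimedean2 by blast
    then have "ennreal (g x) \<le> ennreal (G k x)" by (simp add: G_def)
    then show "ennreal (g x) \<le> (SUP k. ennreal (G k x))" by (meson SUP_upper2 UNIV_I)
    show "(SUP k. ennreal (G k x)) \<le> ennreal (g x)"
      using g by (intro SUP_least ennreal_leI) (auto simp: G_def indicator_def)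
  qed
  also have "\<dots> = (SUP k. \<integral>\<^sup>+x. ennreal (G k x) \<partial>p)"
  proof (rule nn_integral_monotone_convergence_SUP)
    show "incseq (\<lambda>k x. ennreal (G k x))"
      using g by (auto simp: incseq_def le_fun_def G_def indicator_def intro!: ennreal_leI)
  qed auto
  also have "\<dots> \<le> ennreal C"
    using EG intG G0 C by (intro SUP_least) (simp add: nn_integral_eq_integral)
  finally have nn: "(\<integral>\<^sup>+x. ennreal (g x) \<partial>p) \<le> ennreal C" .
  show int: "integrable (measure_pmf p) g"
    by (rule integrableI_bounded) (use nn g in \<open>auto simp: less_top intro: le_less_trans\<close>)
  then show "measure_pmf.expectation p g \<le> C"
    using nn g C by (simp add: nn_integral_eq_integral)
qed

end

section \<open>The generator of the pull-based policy\<close>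

definition queue_mean :: "nat list \<Rightarrow> (nat \<Rightarrow> real) \<Rightarrow> real" where
  "queue_mean q g = (\<Sum>i<length q. g (q ! i)) / real (length q)"

lemma queue_mean_add: "queue_mean q (\<lambda>k. g k + h k) = queue_mean q g + queue_mean q h"
  by (simp add: queue_mean_def sum.distrib add_divide_distrib)

lemma queue_mean_diff: "queue_mean q (\<lambda>k. g k - h k) = queue_mean q g - queue_mean q h"
  by (simp add: queue_mean_def sum_subtractf diff_divide_distrib)

lemma queue_mean_cmult: "queue_mean q (\<lambda>k. a * g k) = a * queue_mean q g"
  by (simp add: queue_mean_def sum_distrib_left)

lemma queue_mean_const: "length q > 0 \<Longrightarrow> queue_mean q (\<lambda>k. a) = a"
  by (simp add: queue_mean_def)

lemma queue_mean_mono: "(\<And>k. g k \<le> h k) \<Longrightarrow> queue_mean q g \<le> queue_mean q h"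
  by (simp add: queue_mean_def divide_right_mono sum_mono)

lemma queue_mean_nonneg: "(\<And>k. 0 \<le> g k) \<Longrightarrow> 0 \<le> queue_mean q g"
  by (simp add: queue_mean_def sum_nonneg)

lemma queue_mean_sum: "queue_mean q (\<lambda>k. \<Sum>j\<in>J. g j k) = (\<Sum>j\<in>J. queue_mean q (g j))"
proof -
  have "(\<Sum>i<length q. \<Sum>j\<in>J. g j (q ! i)) = (\<Sum>j\<in>J. \<Sum>i<length q. g j (q ! i))" by (rule sum.swap)
  then show ?thesis by (simp add: queue_mean_def sum_divide_distrib)
qed

lemma queue_mean_update:
  assumes "i < length q"
  shows "queue_mean (q[i := v]) g = queue_mean q g + (g v - g (q ! i)) / real (length q)"
proof -
  have "(\<Sum>j<length q. g (q[i := v] ! j)) = g v + (\<Sum>j\<in>{..<length q} - {i}. g (q ! j))"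
    using assms by (subst sum.remove[of _ i]) (auto intro!: sum.cong)
  moreover have "(\<Sum>j<length q. g (q ! j)) = g (q ! i) + (\<Sum>j\<in>{..<length q} - {i}. g (q ! j))"
    using assms by (subst sum.remove[of _ i]) auto
  ultimately show ?thesis by (simp add: queue_mean_def flip: add_divide_distrib)
qed

lemma idle_servers_eq: "real (idle_servers q) = (\<Sum>i<length q. of_bool (q ! i = 0))"
proof -
  have "{i. i < length q \<and> q ! i = 0} = {i \<in> {..<length q}. q ! i = 0}" by auto
  then show ?thesis by (simp add: idle_servers_def of_bool_def sum.If_cases Int_def)
qed

definition busy_fraction :: "nat list \<Rightarrow> real" where
  "busy_fraction q = queue_mean q (\<lambda>k. of_bool (k > 0))"

lemma idle_servers_busy_fraction:
  assumes "length q > 0"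
  shows "real (idle_servers q) = real (length q) * (1 - busy_fraction q)"
proof -
  have "1 - busy_fraction q = queue_mean q (\<lambda>k. 1 - of_bool (k > 0))"
    using assms by (simp add: busy_fraction_def queue_mean_diff queue_mean_const)
  also have "\<dots> = queue_mean q (\<lambda>k. of_bool (k = 0))"
    by (rule arg_cong[where f = "queue_mean q"]) auto
  finally show ?thesis using assms by (simp add: queue_mean_def idle_servers_eq)
qed

lemma sum_point_masses:
  fixes a :: "'i \<Rightarrow> real"
  assumes "finite A" "\<And>i. i \<in> I \<Longrightarrow> P \<Longrightarrow> h i \<in> A"
  shows "(\<Sum>y\<in>A. (\<Sum>i\<in>I. if P \<and> y = h i then a i else 0) * g y) =
    (if P then \<Sum>i\<in>I. a i * g (h i) else 0)"
proof (cases P)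
  case True
  have "(\<Sum>y\<in>A. (\<Sum>i\<in>I. if y = h i then a i else 0) * g y) =
    (\<Sum>i\<in>I. \<Sum>y\<in>A. if y = h i then a i * g y else 0)"
    by (subst sum.swap) (auto simp: sum_distrib_right intro!: sum.cong)
  also have "\<dots> = (\<Sum>i\<in>I. a i * g (h i))"
    using assms True by (intro sum.cong) auto
  finally show ?thesis using True by simp
qed simp

text \<open>Both kinds of arrivals lead to \<open>(q[i := q ! i + 1], m - 1)\<close>: truncated subtraction leaves the
  token count at zero when there are no tokens.\<close>
definition arrival_rate :: "real \<Rightarrow> nat list \<Rightarrow> nat \<Rightarrow> nat \<Rightarrow> real" where
  "arrival_rate lam q m i =
     (if m = 0 then lam else real (length q) * lam * of_bool (q ! i = 0) / real (idle_servers q))"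

definition rcpb_targets :: "nat \<Rightarrow> rcpb_state \<Rightarrow> rcpb_state set" where
  "rcpb_targets n = (\<lambda>(q, m). (\<lambda>i. (q[i := q ! i + 1], m - 1)) ` {..<n} \<union>
     (\<lambda>i. (q[i := q ! i - 1], m)) ` {..<n} \<union> {(q, m + 1)})"

lemma sum_rcpb_rate:
  assumes "length q = n"
  shows "(\<Sum>y\<in>rcpb_targets n (q, m). rcpb_rate lam \<mu> n c (q, m) y * g y) =
    (\<Sum>i<n. arrival_rate lam q m i * g (q[i := q ! i + 1], m - 1)) +
    (\<Sum>i<n. of_bool (q ! i > 0) * g (q[i := q ! i - 1], m)) +
    \<mu> * (real (idle_servers q) - real m) * of_bool (m < c) * g (q, m + 1)"
proof -
  let ?A = "rcpb_targets n (q, m)"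
  have fin: "finite ?A" by (simp add: rcpb_targets_def)
  have 1: "(\<Sum>y\<in>?A. (\<Sum>i<n. if m = 0 \<and> y = (q[i := q ! i + 1], 0) then lam else 0) * g y) =
     (if m = 0 then \<Sum>i<n. lam * g (q[i := q ! i + 1], 0) else 0)"
    by (rule sum_point_masses) (auto simp: rcpb_targets_def)
  have 2: "(\<Sum>y\<in>?A. (\<Sum>i<n. if m > 0 \<and> y = (q[i := q ! i + 1], m - 1)
       then real n * lam * of_bool (q ! i = 0) / real (idle_servers q) else 0) * g y) =
     (if m > 0 then \<Sum>i<n. real n * lam * of_bool (q ! i = 0) / real (idle_servers q) *
        g (q[i := q ! i + 1], m - 1) else 0)"
    by (rule sum_point_masses) (auto simp: rcpb_targets_def)
  have 3: "(\<Sum>y\<in>?A. (\<Sum>i<n. if y = (q[i := q ! i - 1], m) then of_bool (q ! i > 0) else 0) * g y) =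
     (\<Sum>i<n. of_bool (q ! i > 0) * g (q[i := q ! i - 1], m))"
    using sum_point_masses[where P = True and A = ?A and I = "{..<n}"
        and h = "\<lambda>i. (q[i := q ! i - 1], m)" and a = "\<lambda>i. of_bool (q ! i > 0)" and g = g]
    by (simp add: rcpb_targets_def)
  have 4: "(\<Sum>y\<in>?A. (if y = (q, m + 1) then \<mu> * (real (idle_servers q) - real m) * of_bool (m < c) else 0) * g y) =
     \<mu> * (real (idle_servers q) - real m) * of_bool (m < c) * g (q, m + 1)"
  proof -
    have "(q, m + 1) \<in> ?A" by (simp add: rcpb_targets_def)
    moreover have "(\<Sum>y\<in>?A. (if y = (q, m + 1) then \<mu> * (real (idle_servers q) - real m) * of_bool (m < c) else 0) * g y) =
      (\<Sum>y\<in>?A. if y = (q, m + 1) then \<mu> * (real (idle_servers q) - real m) * of_bool (m < c) * g (q, m + 1) else 0)"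
      by (intro sum.cong) auto
    ultimately show ?thesis using fin by simp
  qed
  have "(\<Sum>y\<in>?A. rcpb_rate lam \<mu> n c (q, m) y * g y) =
    (if m = 0 then \<Sum>i<n. lam * g (q[i := q ! i + 1], 0) else 0) +
    (if m > 0 then \<Sum>i<n. real n * lam * of_bool (q ! i = 0) / real (idle_servers q) *
        g (q[i := q ! i + 1], m - 1) else 0) +
    (\<Sum>i<n. of_bool (q ! i > 0) * g (q[i := q ! i - 1], m)) +
     \<mu> * (real (idle_servers q) - real m) * of_bool (m < c) * g (q, m + 1)"
    unfolding rcpb_rate_def prod.case distrib_right sum.distrib 1 2 3 4 ..
  then show ?thesis using assms by (simp add: arrival_rate_def)
qed

lemma sum_arrival_rate:
  assumes "length q = n" "m \<le> idle_servers q"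
  shows "(\<Sum>i<n. arrival_rate lam q m i) = real n * lam"
proof (cases "m = 0")
  case False
  then have "real (idle_servers q) > 0" using assms by simp
  moreover have "(\<Sum>i<n. real n * lam * of_bool (q ! i = 0) / real (idle_servers q)) =
      real n * lam * real (idle_servers q) / real (idle_servers q)"
    by (simp only: idle_servers_eq assms(1) sum_divide_distrib sum_distrib_left)
  ultimately show ?thesis using False assms(1) by (simp add: arrival_rate_def)
qed (simp add: arrival_rate_def)

lemma sum_arrival_rate_mult:
  assumes q: "length q = n" and "n > 0" and m: "m \<le> idle_servers q"
  shows "(\<Sum>i<n. arrival_rate lam q m i * g (q ! i)) =
    real n * lam * (if m = 0 then queue_mean q g else g 0)"
proof (cases "m = 0")
  case True
  then show ?thesis using assms
    by (simp add: arrival_rate_def queue_mean_def flip: sum_distrib_left)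
next
  case False
  then have "(\<Sum>i<n. arrival_rate lam q m i * g (q ! i)) = (\<Sum>i<n. arrival_rate lam q m i * g 0)"
    by (intro sum.cong refl) (simp add: arrival_rate_def of_bool_def)
  also have "\<dots> = real n * lam * g 0"
    using sum_arrival_rate[OF q m, of lam] by (simp flip: sum_distrib_right)
  finally show ?thesis using False by simp
qed

lemma rcpb_rate_eq_0:
  assumes "y \<notin> rcpb_targets n (q, m)"
  shows "rcpb_rate lam \<mu> n c (q, m) y = 0"
proof -
  have "y \<noteq> (q[i := q ! i + 1], 0)" if "i < n" "m = 0" for i
    using assms that by (auto simp: rcpb_targets_def)
  moreover have "y \<noteq> (q[i := q ! i + 1], m - 1)" "y \<noteq> (q[i := q ! i - 1], m)" if "i < n" for i
    using assms that by (auto simp: rcpb_targets_def)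
  moreover have "y \<noteq> (q, m + 1)" using assms by (auto simp: rcpb_targets_def)
  ultimately show ?thesis by (simp add: rcpb_rate_def cong: conj_cong)
qed

lemma idle_servers_update:
  assumes "i < length q"
  shows "real (idle_servers (q[i := v])) = real (idle_servers q) + of_bool (v = 0) - of_bool (q ! i = 0)"
proof -
  have "(\<Sum>j<length q. of_bool (q[i := v] ! j = 0)) =
      (of_bool (v = 0) :: real) + (\<Sum>j\<in>{..<length q} - {i}. of_bool (q ! j = 0))"
    using assms by (subst sum.remove[of _ i]) (auto intro!: sum.cong)
  moreover have "(\<Sum>j<length q. of_bool (q ! j = 0)) =
      (of_bool (q ! i = 0) :: real) + (\<Sum>j\<in>{..<length q} - {i}. of_bool (q ! j = 0))"
    using assms by (subst sum.remove[of _ i]) auto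
  ultimately show ?thesis by (simp add: idle_servers_eq)
qed

lemma rcpb_rate_outside_states:
  assumes x: "(q, m) \<in> rcpb_states n c" and y: "y \<notin> rcpb_states n c"
  shows "rcpb_rate lam \<mu> n c (q, m) y = 0"
proof -
  have q: "length q = n" and m: "m \<le> c" "m \<le> idle_servers q"
    using x by (auto simp: rcpb_states_def)
  have arr: "y \<noteq> (q[i := q ! i + 1], m - 1)" if "i < n" "m = 0 \<or> q ! i = 0" for i
  proof -
    have "real (m - 1) \<le> real (idle_servers (q[i := q ! i + 1]))"
    proof (cases "m = 0")
      case False
      then show ?thesis using that m q by (auto simp: idle_servers_update)
    qed simp
    then show ?thesis using y m q by (auto simp: rcpb_states_def)
  qed
  have dep: "y \<noteq> (q[i := q ! i - 1], m)" if "i < n" "q ! i > 0" for i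
  proof -
    have "real m \<le> real (idle_servers (q[i := q ! i - 1]))"
      using that m q by (subst idle_servers_update) auto
    then show ?thesis using y m q by (auto simp: rcpb_states_def)
  qed
  have tok: "y \<noteq> (q, m + 1)" if "m < c" "m \<noteq> idle_servers q"
    using that y m q by (auto simp: rcpb_states_def)
  have arr0: "y \<noteq> (q[i := q ! i + 1], 0)" if "i < n" "m = 0" for i
    using arr[of i] that by simp
  have "(\<Sum>i<n. if m = 0 \<and> y = (q[i := q ! i + 1], 0) then lam else 0) = 0"
    using arr0 by (intro sum.neutral) auto
  moreover have "(\<Sum>i<n. if m > 0 \<and> y = (q[i := q ! i + 1], m - 1)
      then real n * lam * of_bool (q ! i = 0) / real (idle_servers q) else 0) = 0"
    using arr by (intro sum.neutral) auto
  moreover have "(\<Sum>i<n. if y = (q[i := q ! i - 1], m) then of_bool (q ! i > 0) else 0) = (0 :: real)"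
    using dep by (intro sum.neutral) auto
  ultimately show ?thesis
    unfolding rcpb_rate_def prod.case using tok m by (cases "m = idle_servers q \<or> m = c") auto
qed

locale rcpb_steady_state =
  fixes lam \<mu> :: real and n c :: nat and p :: "rcpb_state pmf"
  assumes lam: "0 < lam" "lam < 1" and \<mu>: "0 < \<mu>" and c: "1 \<le> c" "c \<le> n"
    and p: "rcpb_stationary lam \<mu> n c p"
begin

lemma n_pos: "n > 0" using c by simp

sublocale stationary_chain "rcpb_states n c" "rcpb_rate lam \<mu> n c" p "rcpb_targets n"
  "(lam + 1 + \<mu>) * real n"
proof
  show "stationary_distribution (rcpb_states n c) (rcpb_rate lam \<mu> n c) p"
    using p by (simp add: rcpb_stationary_def)
  fix x :: rcpb_state assume x: "x \<in> rcpb_states n c"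
  obtain q m where qm: "x = (q, m)" by force
  have q: "length q = n" "m \<le> idle_servers q" using x qm by (auto simp: rcpb_states_def)
  show "finite (rcpb_targets n x)" by (auto simp: rcpb_targets_def qm)
  show "rcpb_rate lam \<mu> n c x y = 0" if "y \<notin> rcpb_targets n x" for y
    using that qm rcpb_rate_eq_0 by auto
  show "rcpb_rate lam \<mu> n c x y = 0" if "y \<notin> rcpb_states n c" for y
    using that qm rcpb_rate_outside_states x by auto
  show "0 \<le> rcpb_rate lam \<mu> n c x y" for y
    using lam \<mu> q by (auto simp: rcpb_rate_def qm intro!: add_nonneg_nonneg sum_nonneg)
  have "(\<Sum>i<n. of_bool (q ! i > 0) :: real) \<le> (\<Sum>i<n. 1)"
    by (intro sum_mono) auto
  moreover have "\<mu> * (real (idle_servers q) - real m) * of_bool (m < c) \<le> \<mu> * real n"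
  proof -
    have "real (idle_servers q) \<le> (\<Sum>i<n. 1)"
      unfolding idle_servers_eq q by (intro sum_mono) auto
    then have "\<mu> * (real (idle_servers q) - real m) \<le> \<mu> * real n"
      using \<mu> by (intro mult_left_mono) auto
    then show ?thesis using \<mu> by auto
  qed
  ultimately show "sum (rcpb_rate lam \<mu> n c x) (rcpb_targets n x) \<le> (lam + 1 + \<mu>) * real n"
    using sum_rcpb_rate[OF q(1), where m = m and lam = lam and \<mu> = \<mu> and c = c and g = "\<lambda>_. 1"] sum_arrival_rate[OF q, of lam]
    by (simp add: qm algebra_simps)
qed

lemma generator_rcpb:
  assumes "(q, m) \<in> rcpb_states n c"
  shows "generator f (q, m) =
    (\<Sum>i<n. arrival_rate lam q m i * (f (q[i := q ! i + 1], m - 1) - f (q, m))) +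
    (\<Sum>i<n. of_bool (q ! i > 0) * (f (q[i := q ! i - 1], m) - f (q, m))) +
    \<mu> * (real (idle_servers q) - real m) * of_bool (m < c) * (f (q, m + 1) - f (q, m))"
  unfolding generator_def using assms by (subst sum_rcpb_rate) (auto simp: rcpb_states_def)

lemma expectation_generator_rcpb:
  fixes f :: "rcpb_state \<Rightarrow> real"
  assumes w: "integrable (measure_pmf p) w"
    and arrival: "\<And>q m i. length q = n \<Longrightarrow> i < n \<Longrightarrow> \<bar>f (q[i := q ! i + 1], m - 1) - f (q, m)\<bar> \<le> w (q, m)"
    and departure: "\<And>q m i. length q = n \<Longrightarrow> i < n \<Longrightarrow> \<bar>f (q[i := q ! i - 1], m) - f (q, m)\<bar> \<le> w (q, m)"
    and token: "\<And>q m. length q = n \<Longrightarrow> \<bar>f (q, m + 1) - f (q, m)\<bar> \<le> w (q, m)"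
  shows "measure_pmf.expectation p (generator f) = 0" "integrable (measure_pmf p) (generator f)"
proof -
  have "\<bar>f y - f x\<bar> \<le> w x" if x: "x \<in> rcpb_states n c" and y: "y \<in> rcpb_targets n x" for x y
  proof -
    obtain q m where "x = (q, m)" by force
    then show ?thesis
      using x y arrival[of q _ m] departure[of q _ m] token[of q m]
      by (auto simp: rcpb_targets_def rcpb_states_def)
  qed
  then show "measure_pmf.expectation p (generator f) = 0" "integrable (measure_pmf p) (generator f)"
    using expectation_generator[OF w, of f] by auto
qed

text \<open>The changes of a single queue have size \<open>1 / n\<close> in the mean and are summed over \<open>n\<close> queues, so
  no power of \<open>n\<close> remains. With a token in store, the arrival goes to an empty queue.\<close>
lemma generator_queue_mean:
  assumes x: "(q, m) \<in> rcpb_states n c"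
  shows "generator (\<lambda>(q, m). queue_mean q g) (q, m) =
    lam * (if m = 0 then queue_mean q (\<lambda>k. g (k + 1) - g k) else g 1 - g 0) +
    queue_mean q (\<lambda>k. of_bool (k > 0) * (g (k - 1) - g k))"
proof -
  have q: "length q = n" "m \<le> idle_servers q" using x by (auto simp: rcpb_states_def)
  have arr: "(\<Sum>i<n. arrival_rate lam q m i * (queue_mean (q[i := q ! i + 1]) g - queue_mean q g)) =
    (\<Sum>i<n. arrival_rate lam q m i * (g (q ! i + 1) - g (q ! i))) / real n"
    using q by (simp add: queue_mean_update sum_divide_distrib)
  have "(\<Sum>i<n. of_bool (q ! i > 0) * (queue_mean (q[i := q ! i - 1]) g - queue_mean q g)) =
    (\<Sum>i<n. of_bool (q ! i > 0) * (g (q ! i - 1) - g (q ! i)) / real n)"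
    using q by (intro sum.cong refl) (simp add: queue_mean_update)
  also have "\<dots> = queue_mean q (\<lambda>k. of_bool (k > 0) * (g (k - 1) - g k))"
    by (simp only: queue_mean_def q(1) sum_divide_distrib)
  finally have dep: "(\<Sum>i<n. of_bool (q ! i > 0) * (queue_mean (q[i := q ! i - 1]) g - queue_mean q g)) = \<dots>" .
  show ?thesis
    unfolding generator_rcpb[OF x] prod.case arr dep
    using sum_arrival_rate_mult[OF q(1) n_pos q(2), of lam "\<lambda>k. g (k + 1) - g k"] n_pos by simp
qed

end

section \<open>Moments of the queue lengths\<close>

lemma integrable_pmf_dominated:
  fixes f w :: "'a \<Rightarrow> real"
  assumes "integrable (measure_pmf p) w" "\<And>x. x \<in> set_pmf p \<Longrightarrow> \<bar>f x\<bar> \<le> w x"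
  shows "integrable (measure_pmf p) f"
  by (rule Bochner_Integration.integrable_bound[OF assms(1)])
     (use assms(2) in \<open>force simp: AE_measure_pmf_iff\<close>)+

lemma abs_expectation_diff_le:
  fixes f g w :: "'a \<Rightarrow> real"
  assumes "integrable (measure_pmf p) f" "integrable (measure_pmf p) g" "integrable (measure_pmf p) w"
    and "\<And>x. x \<in> set_pmf p \<Longrightarrow> \<bar>f x - g x\<bar> \<le> w x"
  shows "\<bar>measure_pmf.expectation p f - measure_pmf.expectation p g\<bar> \<le> measure_pmf.expectation p w"
proof -
  have "measure_pmf.expectation p f - measure_pmf.expectation p g = measure_pmf.expectation p (\<lambda>x. f x - g x)"
    using assms by simp
  also have "\<bar>\<dots>\<bar> \<le> measure_pmf.expectation p (\<lambda>x. \<bar>f x - g x\<bar>)" by (rule integral_abs_bound)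
  also have "\<dots> \<le> measure_pmf.expectation p w"
    using assms by (intro expectation_mono_pmf integrable_abs) auto
  finally show ?thesis .
qed

definition second_moment_bound :: "real \<Rightarrow> real" where
  "second_moment_bound lam = (1 + 9 / (1 - lam)) / (2 * (1 - lam))"

lemma single_queue_le:
  assumes "i < length q"
  shows "real (q ! i) / real (length q) \<le> queue_mean q real"
proof -
  have "real (q ! i) \<le> (\<Sum>i<length q. real (q ! i))"
    using assms by (intro member_le_sum) auto
  then show ?thesis by (simp add: queue_mean_def divide_right_mono)
qed

lemma busy_fraction_nonneg: "busy_fraction q \<ge> 0"
  by (simp add: busy_fraction_def queue_mean_nonneg)

lemma busy_fraction_le_1: "busy_fraction q \<le> 1"
proof (cases "length q = 0")
  case False
  then have "busy_fraction q \<le> queue_mean q (\<lambda>k. 1)"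
    unfolding busy_fraction_def by (intro queue_mean_mono) auto
  then show ?thesis using False by (simp add: queue_mean_const)
qed (simp add: busy_fraction_def queue_mean_def)

context rcpb_steady_state
begin

abbreviation E :: "(rcpb_state \<Rightarrow> real) \<Rightarrow> real" where
  "E \<equiv> measure_pmf.expectation p"

lemma set_pmf_rcpb:
  assumes "(q, m) \<in> set_pmf p"
  shows "(q, m) \<in> rcpb_states n c" "length q = n" "m \<le> c" "m \<le> idle_servers q" "length q > 0"
  using assms set_pmf_stationary n_pos by (auto simp: rcpb_states_def)

text \<open>The drift of \<open>k ^ 3\<close> is at most \<open>lam * (3 * k\<^sup>2 + 3 * k + 1) - 3 * k\<^sup>2 + 3 * k\<close>, even when all
  arrivals join a uniformly random queue, which is the worst case. As \<open>lam < 1\<close>, the quadratic term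
  is negative, uniformly in \<open>n\<close>, \<open>c\<close> and \<open>\<mu>\<close>.\<close>
lemma second_moment:
  "integrable (measure_pmf p) (\<lambda>(q, m). queue_mean q (\<lambda>k. (real k)\<^sup>2))"
  "E (\<lambda>(q, m). queue_mean q (\<lambda>k. (real k)\<^sup>2)) \<le> second_moment_bound lam"
proof -
  let ?C = "1 + 9 / (1 - lam)"
  let ?Y = "\<lambda>q. queue_mean q (\<lambda>k. (real k)\<^sup>2)"
  let ?g = "\<lambda>(q, m). 2 * (1 - lam) * ?Y q"
  have drift: "generator (\<lambda>(q, m). queue_mean q (\<lambda>k. (real k) ^ 3)) x \<le> ?C - ?g x"
    if x: "x \<in> rcpb_states n c" for x
  proof -
    obtain q m where qm: "x = (q, m)" by force
    have q: "length q > 0" using x qm n_pos by (auto simp: rcpb_states_def)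
    let ?a = "\<lambda>k. (real (k + 1)) ^ 3 - (real k) ^ 3"
    let ?d = "\<lambda>k. of_bool (k > 0) * ((real (k - 1)) ^ 3 - (real k) ^ 3)"
    have a1: "1 \<le> ?a k" for k by (simp add: power3_eq_cube algebra_simps)
    have "1 \<le> queue_mean q ?a"
      using queue_mean_mono[of "\<lambda>_. 1" ?a q] a1 q by (simp add: queue_mean_const)
    then have "lam * (if m = 0 then queue_mean q ?a else real 1 ^ 3 - real 0 ^ 3) \<le> lam * queue_mean q ?a"
      using lam by (intro mult_left_mono) auto
    then have "generator (\<lambda>(q, m). queue_mean q (\<lambda>k. (real k) ^ 3)) x \<le> lam * queue_mean q ?a + queue_mean q ?d"
      using generator_queue_mean[of q m "\<lambda>k. real k ^ 3"] x qm by simp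
    also have "\<dots> = queue_mean q (\<lambda>k. lam * ?a k + ?d k)"
      by (simp only: queue_mean_add queue_mean_cmult)
    also have "\<dots> \<le> queue_mean q (\<lambda>k. ?C - 2 * (1 - lam) * (real k)\<^sup>2)"
    proof (rule queue_mean_mono)
      fix k :: nat
      let ?k = "real k"
      have a: "?a k = 3 * ?k\<^sup>2 + 3 * ?k + 1" by (simp add: power3_eq_cube power2_eq_square algebra_simps)
      have d: "?d k \<le> - 3 * ?k\<^sup>2 + 3 * ?k"
        by (cases k) (auto simp: power3_eq_cube power2_eq_square algebra_simps)
      have "lam * (3 * ?k + 1) \<le> 1 * (3 * ?k + 1)" using lam by (intro mult_right_mono) auto
      \<comment> \<open>Completing the square absorbs the linear term at the cost of a third of the quadratic one,
        which gives the constants of \<open>second_moment_bound\<close>.\<close>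
      moreover have "6 * ?k \<le> (1 - lam) * ?k\<^sup>2 + 9 / (1 - lam)"
      proof -
        have "0 \<le> ((1 - lam) * ?k - 3)\<^sup>2 / (1 - lam)" using lam by simp
        also have "\<dots> = (1 - lam) * ?k\<^sup>2 - 6 * ?k + 9 / (1 - lam)"
          using lam by (simp add: power2_eq_square field_simps)
        finally show ?thesis by simp
      qed
      ultimately show "lam * ?a k + ?d k \<le> ?C - 2 * (1 - lam) * ?k\<^sup>2"
        unfolding a using d by (simp add: algebra_simps)
    qed
    also have "\<dots> = ?C - 2 * (1 - lam) * ?Y q"
      using q by (simp only: queue_mean_diff queue_mean_cmult queue_mean_const)
    finally show ?thesis by (simp add: qm)
  qed
  have nonneg: "queue_mean q (\<lambda>k. real k ^ 3) \<ge> 0" "?Y q \<ge> 0" for q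
    by (simp_all add: queue_mean_nonneg)
  have int: "integrable (measure_pmf p) ?g" and bnd: "E ?g \<le> ?C"
    using foster_bound[where f = "\<lambda>(q, m). queue_mean q (\<lambda>k. (real k) ^ 3)" and g = ?g and C = ?C]
      nonneg drift lam by auto
  have g_eq: "?g = (\<lambda>x. 2 * (1 - lam) * (case x of (q, m) \<Rightarrow> ?Y q))" by auto
  show "integrable (measure_pmf p) (\<lambda>(q, m). ?Y q)"
    using int lam unfolding g_eq by simp
  show "E (\<lambda>(q, m). ?Y q) \<le> second_moment_bound lam"
    using bnd lam unfolding g_eq integral_mult_right_zero second_moment_bound_def
    by (subst pos_le_divide_eq) (simp_all add: mult.commute)
qed

lemma integrable_mean_length_times_bounded:
  assumes "\<And>q m. (q, m) \<in> set_pmf p \<Longrightarrow> \<bar>f q m\<bar> \<le> B"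
  shows "integrable (measure_pmf p) (\<lambda>(q, m). queue_mean q real * f q m)"
proof (rule integrable_pmf_dominated)
  let ?w = "\<lambda>x. B * (case x of (q, m) \<Rightarrow> queue_mean q (\<lambda>k. (real k)\<^sup>2))"
  show "integrable (measure_pmf p) ?w" using second_moment(1) by simp
  fix x assume x: "x \<in> set_pmf p"
  obtain q m where qm: "x = (q, m)" by force
  have "queue_mean q real \<le> queue_mean q (\<lambda>k. (real k)\<^sup>2)"
  proof (rule queue_mean_mono)
    fix k show "real k \<le> (real k)\<^sup>2" by (cases k) (auto simp: power2_eq_square)
  qed
  moreover have "0 \<le> queue_mean q real" by (simp add: queue_mean_nonneg)
  ultimately have "queue_mean q real * \<bar>f q m\<bar> \<le> queue_mean q (\<lambda>k. (real k)\<^sup>2) * B"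
    using assms x qm by (intro mult_mono) auto
  then show "\<bar>case x of (q, m) \<Rightarrow> queue_mean q real * f q m\<bar> \<le> ?w x"
    using \<open>0 \<le> queue_mean q real\<close> by (simp add: qm abs_mult mult.commute)
qed

lemma integrable_mean_length: "integrable (measure_pmf p) (\<lambda>(q, m). queue_mean q real)"
  using integrable_mean_length_times_bounded[of "\<lambda>_ _. 1" 1] by simp

lemma expectation_mean_length_le: "E (\<lambda>(q, m). queue_mean q real) \<le> second_moment_bound lam"
proof -
  have "real k \<le> (real k)\<^sup>2" for k by (cases k) (auto simp: power2_eq_square)
  then have "E (\<lambda>(q, m). queue_mean q real) \<le> E (\<lambda>(q, m). queue_mean q (\<lambda>k. (real k)\<^sup>2))"
    using integrable_mean_length second_moment(1)
    by (intro expectation_mono_pmf) (auto intro: queue_mean_mono)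
  with second_moment(2) show ?thesis by linarith
qed

lemma integrable_busy_fraction: "integrable (measure_pmf p) (\<lambda>(q, m). busy_fraction q)"
  by (rule integrable_pmf_bounded[where B = 1])
     (auto simp: abs_le_iff busy_fraction_le_1 intro: order_trans[OF _ busy_fraction_nonneg])

text \<open>Conservation of jobs: the mean queue length has drift \<open>lam - b\<close>.\<close>
lemma expectation_busy_fraction: "E (\<lambda>(q, m). busy_fraction q) = lam"
proof -
  have "E (generator (\<lambda>(q, m). queue_mean q real)) = 0"
    by (rule expectation_generator_rcpb[where w = "\<lambda>_. 1 / real n"])
       (auto simp: queue_mean_update divide_right_mono)
  also have "E (generator (\<lambda>(q, m). queue_mean q real)) = E (\<lambda>(q, m). lam - busy_fraction q)"
  proof (intro integral_cong_AE AE_pmfI, goal_cases)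
    case (3 x)
    obtain q m where qm: "x = (q, m)" by force
    note q = set_pmf_rcpb[OF 3[unfolded qm]]
    have "queue_mean q (\<lambda>k. of_bool (k > 0) * (real (k - 1) - real k)) = queue_mean q (\<lambda>k. -1 * of_bool (k > 0))"
      by (rule arg_cong[where f = "queue_mean q"]) (auto simp: fun_eq_iff)
    also have "\<dots> = - busy_fraction q"
      unfolding busy_fraction_def by (subst queue_mean_cmult) simp
    finally show ?case
      using generator_queue_mean[OF q(1), of real] q by (simp add: qm queue_mean_const)
  qed auto
  also have "\<dots> = E (\<lambda>x. lam - (case x of (q, m) \<Rightarrow> busy_fraction q))"
    by (simp add: case_prod_unfold)
  also have "\<dots> = lam - E (\<lambda>(q, m). busy_fraction q)"
    using integrable_busy_fraction by simp
  finally show ?thesis by simp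
qed

text \<open>The drift of the mean of \<open>k\<^sup>2\<close> is \<open>2 * lam * x * of_bool (m = 0) + lam + b - 2 * x\<close>: an
  arrival that finds a token joins an empty queue and adds just \<open>1\<close>, whereas without tokens it adds
  \<open>2 * k + 1\<close> to a queue of length \<open>k\<close> chosen at random.\<close>
lemma expectation_mean_length:
  "E (\<lambda>(q, m). queue_mean q real) = lam + lam * E (\<lambda>(q, m). queue_mean q real * of_bool (m = 0))"
proof -
  let ?f = "\<lambda>(q, m). queue_mean q (\<lambda>k. (real k)\<^sup>2)"
  let ?x = "\<lambda>(q, m). queue_mean q real" and ?z = "\<lambda>(q, m). queue_mean q real * of_bool (m = 0)"
  let ?b = "\<lambda>(q, m). busy_fraction q"
  have int0: "integrable (measure_pmf p) ?z"
    by (rule integrable_mean_length_times_bounded[where B = 1]) auto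
  have "E (generator ?f) = 0"
  proof (rule expectation_generator_rcpb[where w = "\<lambda>x. 2 * (case x of (q, m) \<Rightarrow> queue_mean q real) + 1"])
    show "integrable (measure_pmf p) (\<lambda>x. 2 * (case x of (q, m) \<Rightarrow> queue_mean q real) + 1)"
      using integrable_mean_length by simp
    fix q :: "nat list" and m i :: nat
    assume q: "length q = n"
    have x0: "0 \<le> queue_mean q real" by (simp add: queue_mean_nonneg)
    show "\<bar>?f (q, m + 1) - ?f (q, m)\<bar> \<le> 2 * (case (q, m) of (q, m) \<Rightarrow> queue_mean q real) + 1"
      using x0 by simp
    assume i: "i < n"
    have n1: "1 / real n \<le> 1" using n_pos by simp
    have le: "(2 * real (q ! i) + 1) / real n \<le> 2 * queue_mean q real + 1"
    proof -
      have "(2 * real (q ! i) + 1) / real n = 2 * (real (q ! i) / real n) + 1 / real n"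
        by (simp add: add_divide_distrib)
      then show ?thesis using single_queue_le[of i q, unfolded q, OF i] n1 by linarith
    qed
    have "?f (q[i := q ! i + 1], m - 1) - ?f (q, m) = (2 * real (q ! i) + 1) / real n"
      using q i by (simp add: queue_mean_update power2_eq_square algebra_simps)
    then show "\<bar>?f (q[i := q ! i + 1], m - 1) - ?f (q, m)\<bar> \<le> 2 * (case (q, m) of (q, m) \<Rightarrow> queue_mean q real) + 1"
      using le x0 by simp
    have "\<bar>(real (q ! i - 1))\<^sup>2 - (real (q ! i))\<^sup>2\<bar> \<le> 2 * real (q ! i) + 1"
      by (cases "q ! i") (auto simp: power2_eq_square algebra_simps)
    then have "\<bar>?f (q[i := q ! i - 1], m) - ?f (q, m)\<bar> \<le> (2 * real (q ! i) + 1) / real n"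
      using q i by (simp add: queue_mean_update divide_right_mono)
    then show "\<bar>?f (q[i := q ! i - 1], m) - ?f (q, m)\<bar> \<le> 2 * (case (q, m) of (q, m) \<Rightarrow> queue_mean q real) + 1"
      using le by simp
  qed
  also have "E (generator ?f) = E (\<lambda>x. 2 * lam * ?z x + lam + ?b x - 2 * ?x x)"
  proof (intro integral_cong_AE AE_pmfI, goal_cases)
    case (3 x)
    obtain q m where qm: "x = (q, m)" by force
    note q = set_pmf_rcpb[OF 3[unfolded qm]]
    have "(real (k + 1))\<^sup>2 - (real k)\<^sup>2 = 2 * real k + 1" for k
      by (simp add: power2_eq_square algebra_simps)
    then have arr: "queue_mean q (\<lambda>k. (real (k + 1))\<^sup>2 - (real k)\<^sup>2) = 2 * queue_mean q real + 1"
      using q by (simp only: queue_mean_add queue_mean_cmult queue_mean_const)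
    have "of_bool (k > 0) * ((real (k - 1))\<^sup>2 - (real k)\<^sup>2) = of_bool (k > 0) - 2 * real k" for k
      by (cases k) (auto simp: power2_eq_square algebra_simps)
    then have dep: "queue_mean q (\<lambda>k. of_bool (k > 0) * ((real (k - 1))\<^sup>2 - (real k)\<^sup>2)) =
        busy_fraction q - 2 * queue_mean q real"
      unfolding busy_fraction_def by (simp only: queue_mean_diff queue_mean_cmult)
    show ?case
      unfolding qm generator_queue_mean[OF q(1)] arr dep by (simp add: algebra_simps)
  qed auto
  also have "\<dots> = 2 * lam * E ?z + lam + E ?b - 2 * E ?x"
    using int0 integrable_mean_length integrable_busy_fraction by simp
  finally show ?thesis by (simp add: expectation_busy_fraction)
qed

end

section \<open>Averaging over the token count\<close>

lemma geometric_comparison: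
  fixes e :: "nat \<Rightarrow> real"
  assumes \<rho>: "\<rho> \<ge> 0" and \<eta>: "\<eta> \<ge> 0" and step: "\<And>k. k < c \<Longrightarrow> e (Suc k) \<ge> \<rho> * e k - \<eta>"
  shows "(\<Sum>k\<le>c. e k) \<ge> (\<Sum>k\<le>c. \<rho> ^ k) * (e 0 - (real c + 1) * \<eta>)"
proof -
  let ?D = "\<Sum>k\<le>c. \<rho> ^ k"
  have e: "e k \<ge> \<rho> ^ k * e 0 - \<eta> * (\<Sum>j<k. \<rho> ^ j)" if "k \<le> c" for k
    using that
  proof (induction k)
    case (Suc k)
    have "(\<Sum>j<Suc k. \<rho> ^ j) = 1 + \<rho> * (\<Sum>j<k. \<rho> ^ j)"
      by (subst sum.lessThan_Suc_shift) (simp add: sum_distrib_left)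
    moreover have "\<rho> * (\<rho> ^ k * e 0 - \<eta> * (\<Sum>j<k. \<rho> ^ j)) \<le> \<rho> * e k"
      using Suc \<rho> by (intro mult_left_mono) auto
    ultimately show ?case using step[of k] Suc.prems by (simp add: algebra_simps)
  qed simp
  have "e k \<ge> \<rho> ^ k * e 0 - \<eta> * ?D" if k: "k \<in> {..c}" for k
  proof -
    have "(\<Sum>j<k. \<rho> ^ j) \<le> ?D" using k \<rho> by (intro sum_mono2) auto
    then have "\<eta> * (\<Sum>j<k. \<rho> ^ j) \<le> \<eta> * ?D" using \<eta> by (intro mult_left_mono) auto
    with e[of k] k show ?thesis by auto
  qed
  then have "(\<Sum>k\<le>c. \<rho> ^ k * e 0 - \<eta> * ?D) \<le> (\<Sum>k\<le>c. e k)" by (rule sum_mono)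
  then show ?thesis by (simp add: sum_subtractf algebra_simps flip: sum_distrib_left)
qed

context rcpb_steady_state
begin

text \<open>Tokens arrive and leave at rates of order \<open>n\<close>, whereas \<open>\<psi>\<close> changes by at most \<open>L\<close> in each of the
  at most \<open>(lam + 1) * n\<close> moves of queues per unit time. So the mean-zero identity for
  \<open>\<psi> q * of_bool (m \<le> k)\<close>, divided by \<open>n\<close>, equates up to \<open>(lam + 1) * L\<close> the flow from \<open>k + 1\<close> to
  \<open>k\<close> tokens with the flow back. The second error term comes from the idle servers whose identity is
  already stored: the token rate is \<open>\<mu>\<close> times the number of idle servers minus \<open>m\<close>, with \<open>m \<le> c\<close>.\<close>
lemma token_balance:
  assumes int: "integrable (measure_pmf p) (\<lambda>(q, m). \<psi> q)"
    and up: "\<And>q i. length q = n \<Longrightarrow> i < n \<Longrightarrow> \<bar>\<psi> (q[i := q ! i + 1]) - \<psi> q\<bar> \<le> L"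
    and down: "\<And>q i. length q = n \<Longrightarrow> i < n \<Longrightarrow> \<bar>\<psi> (q[i := q ! i - 1]) - \<psi> q\<bar> \<le> L"
    and k: "k < c" and L: "L \<ge> 0"
  shows "\<bar>E (\<lambda>(q, m). \<psi> q * (lam * of_bool (m = k + 1) - \<mu> * (1 - busy_fraction q) * of_bool (m = k)))\<bar>
     \<le> (lam + 1) * L + \<mu> * real c / real n * E (\<lambda>(q, m). \<bar>\<psi> q\<bar>)"
proof -
  let ?f = "\<lambda>(q, m). \<psi> q * of_bool (m \<le> k)"
  let ?h = "\<lambda>(q, m). \<psi> q * (lam * of_bool (m = k + 1) - \<mu> * (1 - busy_fraction q) * of_bool (m = k))"
  let ?a = "\<lambda>(q, m). \<bar>\<psi> q\<bar>"
  have inta: "integrable (measure_pmf p) ?a"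
    using integrable_abs[OF int] by (simp add: case_prod_unfold)
  have intw: "integrable (measure_pmf p) (\<lambda>x. L + ?a x)" using inta by simp
  have "\<bar>?f (q[i := q ! i + 1], m - 1) - ?f (q, m)\<bar> \<le> L + ?a (q, m)"
    if "length q = n" "i < n" for q i m
    using L up[OF that] by (auto simp: of_bool_def)
  moreover have "\<bar>?f (q[i := q ! i - 1], m) - ?f (q, m)\<bar> \<le> L + ?a (q, m)"
    if "length q = n" "i < n" for q i m
    using L down[OF that] by (auto simp: of_bool_def)
  moreover have "\<bar>?f (q, m + 1) - ?f (q, m)\<bar> \<le> L + ?a (q, m)" for q m
    using L by (auto simp: of_bool_def)
  ultimately have gen: "E (generator ?f) = 0" "integrable (measure_pmf p) (generator ?f)"
    using expectation_generator_rcpb[OF intw, of ?f] by blast+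
  have inth: "integrable (measure_pmf p) ?h"
  proof (rule integrable_pmf_dominated)
    show "integrable (measure_pmf p) (\<lambda>x. (lam + \<mu>) * ?a x)" using inta by simp
    fix x assume "x \<in> set_pmf p"
    obtain q m where qm: "x = (q, m)" by force
    have "\<bar>lam * of_bool (m = k + 1) - \<mu> * (1 - busy_fraction q) * of_bool (m = k)\<bar> \<le> lam + \<mu>"
    proof -
      define t where "t = \<mu> * (1 - busy_fraction q)"
      have "t \<le> \<mu> * 1" "0 \<le> t"
        unfolding t_def using \<mu> busy_fraction_nonneg[of q] busy_fraction_le_1[of q]
        by (auto intro!: mult_left_mono)
      then show ?thesis unfolding t_def[symmetric] using lam \<mu> by (auto simp: of_bool_def)
    qed
    then show "\<bar>?h x\<bar> \<le> (lam + \<mu>) * ?a x"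
      by (simp add: qm abs_mult mult.commute[of "\<bar>\<psi> q\<bar>"] mult_right_mono)
  qed
  have "\<bar>E (\<lambda>x. real n * ?h x) - E (generator ?f)\<bar> \<le> E (\<lambda>x. real n * ((lam + 1) * L) + \<mu> * real c * ?a x)"
  proof (intro abs_expectation_diff_le gen(2))
    show "integrable (measure_pmf p) (\<lambda>x. real n * ?h x)" using inth by simp
    show "integrable (measure_pmf p) (\<lambda>x. real n * ((lam + 1) * L) + \<mu> * real c * ?a x)" using inta by simp
    fix x assume x: "x \<in> set_pmf p"
    obtain q m where qm: "x = (q, m)" by force
    note q = set_pmf_rcpb[OF x[unfolded qm]]
    define U where "U = (\<Sum>i<n. arrival_rate lam q m i * (\<psi> (q[i := q ! i + 1]) - \<psi> q))"
    define W where "W = (\<Sum>i<n. of_bool (q ! i > 0) * (\<psi> (q[i := q ! i - 1]) - \<psi> q))"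
    have arr0: "arrival_rate lam q m i \<ge> 0" for i using lam by (simp add: arrival_rate_def)
    have "\<bar>U\<bar> \<le> (\<Sum>i<n. arrival_rate lam q m i * L)"
      unfolding U_def using arr0 up q by (intro order_trans[OF sum_abs] sum_mono) (auto simp: abs_mult intro!: mult_left_mono)
    also have "\<dots> = real n * lam * L"
      using sum_arrival_rate[OF q(2) q(4), of lam] by (simp flip: sum_distrib_right)
    finally have U: "\<bar>U\<bar> \<le> real n * lam * L" .
    have "\<bar>W\<bar> \<le> (\<Sum>i<n. L)"
      unfolding W_def using down q L by (intro order_trans[OF sum_abs] sum_mono) (auto simp: abs_mult of_bool_def)
    then have W: "\<bar>W\<bar> \<le> real n * L" by simp
    have arr: "(\<Sum>i<n. arrival_rate lam q m i * (\<psi> (q[i := q ! i + 1]) * of_bool (m - 1 \<le> k) - \<psi> q * of_bool (m \<le> k)))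
      = of_bool (m - 1 \<le> k) * U + real n * lam * \<psi> q * of_bool (m = k + 1)"
    proof -
      have "arrival_rate lam q m i * (\<psi> (q[i := q ! i + 1]) * of_bool (m - 1 \<le> k) - \<psi> q * of_bool (m \<le> k)) =
        of_bool (m - 1 \<le> k) * (arrival_rate lam q m i * (\<psi> (q[i := q ! i + 1]) - \<psi> q)) +
        arrival_rate lam q m i * (\<psi> q * of_bool (m = k + 1))" for i
        by (auto simp: of_bool_def algebra_simps)
      then show ?thesis
        using sum_arrival_rate[OF q(2) q(4), of lam]
        by (simp only: U_def sum.distrib flip: sum_distrib_left sum_distrib_right)
    qed
    have dep: "(\<Sum>i<n. of_bool (q ! i > 0) * (\<psi> (q[i := q ! i - 1]) * of_bool (m \<le> k) - \<psi> q * of_bool (m \<le> k)))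
      = of_bool (m \<le> k) * W"
      unfolding W_def by (cases "m \<le> k") simp_all
    have tok: "\<mu> * (real (idle_servers q) - real m) * of_bool (m < c) * (\<psi> q * of_bool (m + 1 \<le> k) - \<psi> q * of_bool (m \<le> k))
      = - (real n * \<mu> * (1 - busy_fraction q) * \<psi> q * of_bool (m = k)) + \<mu> * real m * \<psi> q * of_bool (m = k)"
    proof (cases "m = k")
      case True
      then show ?thesis
        unfolding idle_servers_busy_fraction[OF q(5)] using k q(2) by (simp add: algebra_simps)
    qed auto
    have "generator ?f (q, m) = of_bool (m - 1 \<le> k) * U + real n * lam * \<psi> q * of_bool (m = k + 1) +
      of_bool (m \<le> k) * W +
      (- (real n * \<mu> * (1 - busy_fraction q) * \<psi> q * of_bool (m = k)) + \<mu> * real m * \<psi> q * of_bool (m = k))"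
      unfolding generator_rcpb[OF q(1)] prod.case arr dep tok ..
    then have "real n * ?h (q, m) - generator ?f (q, m) =
      - of_bool (m - 1 \<le> k) * U - of_bool (m \<le> k) * W - \<mu> * real m * \<psi> q * of_bool (m = k)"
      by (simp add: algebra_simps)
    also have "\<bar>\<dots>\<bar> \<le> \<bar>U\<bar> + \<bar>W\<bar> + \<bar>\<mu> * real m * \<psi> q\<bar>"
      by (auto simp: of_bool_def)
    also have "\<bar>\<mu> * real m * \<psi> q\<bar> \<le> \<mu> * real c * \<bar>\<psi> q\<bar>"
      using \<mu> q by (auto simp: abs_mult intro!: mult_right_mono mult_left_mono)
    finally show "\<bar>real n * ?h x - generator ?f x\<bar> \<le> real n * ((lam + 1) * L) + \<mu> * real c * ?a x"
      using U W unfolding qm by (simp add: algebra_simps)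
  qed
  also have "\<dots> = real n * ((lam + 1) * L) + \<mu> * real c * E ?a" using inta by simp
  finally have "real n * \<bar>E ?h\<bar> \<le> real n * ((lam + 1) * L) + \<mu> * real c * E ?a"
    using inth gen(1) by (simp add: abs_mult)
  then show ?thesis using n_pos by (simp add: field_simps)
qed

definition token_ratio :: real where
  "token_ratio = \<mu> * (1 - lam) / lam"

definition token_weight :: real where
  "token_weight = (\<Sum>k\<le>c. token_ratio ^ k)"

lemma token_ratio_nonneg: "token_ratio \<ge> 0"
  using lam \<mu> by (simp add: token_ratio_def)

lemma token_weight_ge_1: "token_weight \<ge> 1"
proof -
  have "token_ratio ^ 0 \<le> token_weight"
    unfolding token_weight_def using token_ratio_nonneg by (intro member_le_sum) auto
  then show ?thesis by simp
qed

lemma abs_busy_fraction_deviation_le: "\<bar>busy_fraction q - lam\<bar> \<le> 1"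
  using lam busy_fraction_nonneg[of q] busy_fraction_le_1[of q] by linarith

lemma integrable_busy_fraction_excess:
  "integrable (measure_pmf p) (\<lambda>(q, m). max 0 (busy_fraction q - lam))"
  by (rule integrable_pmf_bounded[where B = 1])
    (use abs_busy_fraction_deviation_le in \<open>auto simp: max_def abs_le_iff\<close>)
lemma expectation_split_tokens:
  assumes "integrable (measure_pmf p) (\<lambda>(q, m). \<psi> q)"
  shows "E (\<lambda>(q, m). \<psi> q) = (\<Sum>k\<le>c. E (\<lambda>(q, m). \<psi> q * of_bool (m = k)))"
proof -
  have int: "integrable (measure_pmf p) (\<lambda>(q, m). \<psi> q * of_bool (m = k))" for k
    by (rule integrable_pmf_dominated[where w = "\<lambda>x. \<bar>case x of (q, m) \<Rightarrow> \<psi> q\<bar>"])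
       (use integrable_abs[OF assms] in \<open>auto simp: case_prod_unfold of_bool_def\<close>)
  have "E (\<lambda>(q, m). \<psi> q) = E (\<lambda>x. \<Sum>k\<le>c. (case x of (q, m) \<Rightarrow> \<psi> q * of_bool (m = k)))"
    by (intro integral_cong_AE AE_pmfI) (auto dest: set_pmf_rcpb simp flip: sum_distrib_left simp: of_bool_def)
  also have "\<dots> = (\<Sum>k\<le>c. E (\<lambda>(q, m). \<psi> q * of_bool (m = k)))"
    using int by (intro Bochner_Integration.integral_sum) auto
  finally show ?thesis .
qed

text \<open>A one-sided bound on \<open>(b - lam) * \<psi>\<close> allows the true birth rate \<open>\<mu> * (1 - b)\<close> of tokens to be
  replaced by its equilibrium value \<open>\<mu> * (1 - lam)\<close> in the balance equations, at the price of \<open>\<mu> * E w\<close>.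
  One side suffices because the equations are only used as a lower bound on \<open>k + 1\<close> tokens in terms
  of \<open>k\<close> tokens; iterating it compares the whole expectation with the part on \<open>m = 0\<close>. For the
  function used for concentration only one side is available.\<close>
lemma token_averaging:
  assumes int: "integrable (measure_pmf p) (\<lambda>(q, m). \<psi> q)"
    and up: "\<And>q i. length q = n \<Longrightarrow> i < n \<Longrightarrow> \<bar>\<psi> (q[i := q ! i + 1]) - \<psi> q\<bar> \<le> L"
    and down: "\<And>q i. length q = n \<Longrightarrow> i < n \<Longrightarrow> \<bar>\<psi> (q[i := q ! i - 1]) - \<psi> q\<bar> \<le> L"
    and L: "L \<ge> 0"
    and intw: "integrable (measure_pmf p) (\<lambda>(q, m). w q)"
    and w: "\<And>q m. (q, m) \<in> set_pmf p \<Longrightarrow> (busy_fraction q - lam) * \<psi> q \<le> w q" and w0: "\<And>q. w q \<ge> 0"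
  shows "token_weight * (E (\<lambda>(q, m). \<psi> q * of_bool (m = 0)) - (real c + 1) *
      (((lam + 1) * L + \<mu> * real c / real n * E (\<lambda>(q, m). \<bar>\<psi> q\<bar>) + \<mu> * E (\<lambda>(q, m). w q)) / lam))
    \<le> E (\<lambda>(q, m). \<psi> q)"
proof -
  let ?\<epsilon> = "(lam + 1) * L + \<mu> * real c / real n * E (\<lambda>(q, m). \<bar>\<psi> q\<bar>)"
  let ?e = "\<lambda>k. E (\<lambda>(q, m). \<psi> q * of_bool (m = k))"
  let ?\<eta> = "(?\<epsilon> + \<mu> * E (\<lambda>(q, m). w q)) / lam"
  have "E (\<lambda>(q, m). \<bar>\<psi> q\<bar>) \<ge> 0" "E (\<lambda>(q, m). w q) \<ge> 0"
    using w0 by (auto intro!: integral_nonneg_AE)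
  then have \<eta>: "?\<eta> \<ge> 0" using lam \<mu> L by (intro divide_nonneg_nonneg add_nonneg_nonneg mult_nonneg_nonneg) auto
  have int_mult: "integrable (measure_pmf p) (\<lambda>(q, m). \<psi> q * f q m)" if "\<And>q m. \<bar>f q m\<bar> \<le> 1" for f
  proof (rule integrable_pmf_dominated)
    show "integrable (measure_pmf p) (\<lambda>x. \<bar>case x of (q, m) \<Rightarrow> \<psi> q\<bar>)"
      using int by (rule integrable_abs)
    fix x
    show "\<bar>case x of (q, m) \<Rightarrow> \<psi> q * f q m\<bar> \<le> \<bar>case x of (q, m) \<Rightarrow> \<psi> q\<bar>"
      using that by (cases x) (auto simp: abs_mult intro!: mult_left_le)
  qed
  have step: "?e (Suc k) \<ge> token_ratio * ?e k - ?\<eta>" if k: "k < c" for k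
  proof -
    let ?h = "\<lambda>(q, m). \<psi> q * (lam * of_bool (m = k + 1) - \<mu> * (1 - busy_fraction q) * of_bool (m = k))"
    let ?d = "\<lambda>(q, m). \<psi> q * ((busy_fraction q - lam) * of_bool (m = k))"
    have intd: "integrable (measure_pmf p) ?d"
      using abs_busy_fraction_deviation_le by (intro int_mult) (auto simp: of_bool_def)
    have inte: "integrable (measure_pmf p) (\<lambda>(q, m). \<psi> q * of_bool (m = k))" for k
      by (rule int_mult) auto
    have ratio: "lam * token_ratio = \<mu> * (1 - lam)" using lam by (simp add: token_ratio_def)
    have "E ?h = E (\<lambda>x. lam * (case x of (q, m) \<Rightarrow> \<psi> q * of_bool (m = Suc k)) -
       lam * token_ratio * (case x of (q, m) \<Rightarrow> \<psi> q * of_bool (m = k)) + \<mu> * ?d x)"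
      unfolding ratio by (intro Bochner_Integration.integral_cong) (auto simp: algebra_simps)
    also have "\<dots> = lam * ?e (Suc k) - lam * token_ratio * ?e k + \<mu> * E ?d"
      using inte intd by simp
    finally have h: "E ?h = lam * ?e (Suc k) - lam * token_ratio * ?e k + \<mu> * E ?d" .
    have "E ?d \<le> E (\<lambda>(q, m). w q)"
    proof (intro expectation_mono_pmf intd intw)
      fix x assume "x \<in> set_pmf p"
      then show "?d x \<le> (case x of (q, m) \<Rightarrow> w q)"
        using w w0 by (cases x) (auto simp: of_bool_def mult.commute)
    qed
    then have "\<mu> * E ?d \<le> \<mu> * E (\<lambda>(q, m). w q)" using \<mu> by (intro mult_left_mono) auto
    moreover have "\<bar>E ?h\<bar> \<le> ?\<epsilon>" by (rule token_balance[OF int up down k L])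
    ultimately have "lam * token_ratio * ?e k - (?\<epsilon> + \<mu> * E (\<lambda>(q, m). w q)) \<le> lam * ?e (Suc k)"
      using h by linarith
    then have "(lam * token_ratio * ?e k - (?\<epsilon> + \<mu> * E (\<lambda>(q, m). w q))) / lam \<le> ?e (Suc k)"
      using lam by (simp add: pos_divide_le_eq mult.commute)
    then show ?thesis using lam by (simp add: diff_divide_distrib)
  qed
  have "token_weight * (?e 0 - (real c + 1) * ?\<eta>) \<le> (\<Sum>k\<le>c. ?e k)"
    unfolding token_weight_def by (rule geometric_comparison[where e = ?e, OF token_ratio_nonneg \<eta> step])
  also have "\<dots> = E (\<lambda>(q, m). \<psi> q)" by (rule expectation_split_tokens[OF int, symmetric])
  finally show ?thesis .
qed

text \<open>Token averaging for \<open>x\<close> and for \<open>- x\<close>, combined with the identity for the second moment, which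
  expresses the part of \<open>E x\<close> on \<open>m = 0\<close> as \<open>(E x - lam) / lam\<close>.\<close>
lemma mean_length_averaging:
  defines "x \<equiv> E (\<lambda>(q, m). queue_mean q real)"
    and "d \<equiv> E (\<lambda>(q, m). queue_mean q real * \<bar>busy_fraction q - lam\<bar>)"
  shows "\<bar>x - token_weight * ((x - lam) / lam)\<bar> \<le>
    token_weight * (real c + 1) * (((lam + 1) / real n + \<mu> * real c / real n * x + \<mu> * d) / lam)"
proof -
  let ?z = "E (\<lambda>(q, m). queue_mean q real * of_bool (m = 0))"
  have x0: "?z = (x - lam) / lam" using expectation_mean_length lam by (simp add: x_def)
  have xn: "queue_mean q real \<ge> 0" for q by (simp add: queue_mean_nonneg)
  have int: "integrable (measure_pmf p) (\<lambda>(q, m). queue_mean q real)" by (rule integrable_mean_length)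
  have intm: "integrable (measure_pmf p) (\<lambda>(q, m). - queue_mean q real)"
    using integrable_mean_length by (simp add: case_prod_unfold)
  have intw: "integrable (measure_pmf p) (\<lambda>(q, m). queue_mean q real * \<bar>busy_fraction q - lam\<bar>)"
    using abs_busy_fraction_deviation_le by (intro integrable_mean_length_times_bounded[where B = 1]) auto
  have up: "\<bar>queue_mean (q[i := q ! i + 1]) real - queue_mean q real\<bar> \<le> 1 / real n"
    and down: "\<bar>queue_mean (q[i := q ! i - 1]) real - queue_mean q real\<bar> \<le> 1 / real n"
    if "length q = n" "i < n" for q i
    using that by (auto simp: queue_mean_update divide_right_mono)
  have w: "(busy_fraction q - lam) * queue_mean q real \<le> queue_mean q real * \<bar>busy_fraction q - lam\<bar>"
    "(busy_fraction q - lam) * - queue_mean q real \<le> queue_mean q real * \<bar>busy_fraction q - lam\<bar>" for q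
    using mult_left_mono[OF abs_ge_self xn[of q], of "busy_fraction q - lam"]
      mult_left_mono[OF abs_ge_minus_self xn[of q], of "busy_fraction q - lam"]
    by (simp_all add: algebra_simps)
  define \<eta> where "\<eta> = ((lam + 1) / real n + \<mu> * real c / real n * x + \<mu> * d) / lam"
  have lower: "token_weight * (?z - (real c + 1) * \<eta>) \<le> x"
    using token_averaging[OF int up down _ intw w(1)] xn by (simp add: x_def d_def \<eta>_def)
  have neg: "E (\<lambda>(q, m). - queue_mean q real) = - x"
    "E (\<lambda>(q, m). - queue_mean q real * of_bool (m = 0)) = - ?z"
    by (simp_all add: x_def case_prod_unfold)
  have up': "\<bar>- queue_mean (q[i := q ! i + 1]) real - - queue_mean q real\<bar> \<le> 1 / real n"
    and down': "\<bar>- queue_mean (q[i := q ! i - 1]) real - - queue_mean q real\<bar> \<le> 1 / real n"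
    if "length q = n" "i < n" for q i
    using up[OF that] down[OF that] by auto
  have upper: "token_weight * (- ?z - (real c + 1) * \<eta>) \<le> - x"
    using token_averaging[OF intm up' down' _ intw w(2)] xn unfolding neg by (simp add: x_def d_def \<eta>_def)
  show ?thesis
    using lower upper unfolding x0[symmetric] \<eta>_def[symmetric] by (simp add: algebra_simps abs_le_iff)
qed

end

section \<open>A smoothed positive part\<close>

definition ramp :: "real \<Rightarrow> real \<Rightarrow> real" where
  "ramp \<delta> u = max 0 (min 1 (u / \<delta>))"

text \<open>An antiderivative of the ramp, written as the maximum of \<open>t * u - \<delta> * t\<^sup>2 / 2\<close> over
  \<open>t \<in> {0..1}\<close>, which the ramp attains. It lies within \<open>\<delta>\<close> of \<open>max 0 u\<close>, and the maximum makes its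
  increments easy to bound.\<close>
definition ramp_integral :: "real \<Rightarrow> real \<Rightarrow> real" where
  "ramp_integral \<delta> u = ramp \<delta> u * u - \<delta> * (ramp \<delta> u)\<^sup>2 / 2"

lemma ramp_nonneg: "0 \<le> ramp \<delta> u" and ramp_le_1: "ramp \<delta> u \<le> 1"
  by (auto simp: ramp_def)

lemma ramp_eq_0: "\<delta> > 0 \<Longrightarrow> u \<le> 0 \<Longrightarrow> ramp \<delta> u = 0"
  by (simp add: ramp_def divide_le_0_iff)

lemma ramp_eq_1: "\<delta> > 0 \<Longrightarrow> u \<ge> \<delta> \<Longrightarrow> ramp \<delta> u = 1"
  by (simp add: ramp_def le_divide_eq)

lemma ramp_lipschitz:
  assumes "\<delta> > 0"
  shows "\<bar>ramp \<delta> v - ramp \<delta> u\<bar> \<le> \<bar>v - u\<bar> / \<delta>"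
proof -
  have "\<bar>ramp \<delta> v - ramp \<delta> u\<bar> \<le> \<bar>v / \<delta> - u / \<delta>\<bar>"
    by (auto simp: ramp_def max_def min_def)
  also have "\<dots> = \<bar>v - u\<bar> / \<delta>"
    using assms by (simp add: abs_divide flip: diff_divide_distrib)
  finally show ?thesis .
qed

text \<open>This is where the smoothing costs \<open>\<delta>\<close>. For the indicator of \<open>u > 0\<close> in place of the ramp the
  product would be nonpositive.\<close>
lemma ramp_gain_le:
  assumes \<delta>: "\<delta> > 0" and s: "0 \<le> s" "s \<le> 1"
  shows "u * (s - ramp \<delta> u) \<le> \<delta>"
proof -
  consider "u \<le> 0" | "0 \<le> u" "u \<le> \<delta>" | "u \<ge> \<delta>" by linarith
  then show ?thesis
  proof cases
    case 1
    then have "u * s \<le> 0" using s by (simp add: mult_nonpos_nonneg)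
    then show ?thesis using 1 \<delta> by (simp add: ramp_eq_0)
  next
    case 2
    have "u * (s - ramp \<delta> u) \<le> u * 1"
      using 2 s ramp_nonneg[of \<delta> u] by (intro mult_left_mono) auto
    then show ?thesis using 2 by simp
  next
    case 3
    then have "u * (s - 1) \<le> 0" using s \<delta> by (intro mult_nonneg_nonpos) auto
    then show ?thesis using 3 \<delta> by (simp add: ramp_eq_1)
  qed
qed

lemma ramp_integral_increment:
  assumes \<delta>: "\<delta> > 0"
  shows "ramp_integral \<delta> v - ramp_integral \<delta> u \<le> ramp \<delta> u * (v - u) + (v - u)\<^sup>2 / \<delta>"
proof -
  define s t where "s = ramp \<delta> u" and "t = ramp \<delta> v"
  have t: "0 \<le> t" "t \<le> 1" by (auto simp: t_def ramp_nonneg ramp_le_1)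
  have opt: "t * u - \<delta> * t\<^sup>2 / 2 \<le> s * u - \<delta> * s\<^sup>2 / 2"
  proof -
    consider "u \<le> 0" | "0 \<le> u" "u \<le> \<delta>" | "u \<ge> \<delta>" by linarith
    then show ?thesis
    proof cases
      case 1
      then have "t * u \<le> 0" using t by (simp add: mult_nonneg_nonpos)
      moreover have "0 \<le> \<delta> * t\<^sup>2 / 2" using \<delta> by simp
      ultimately have "t * u - \<delta> * t\<^sup>2 / 2 \<le> 0" by linarith
      then show ?thesis using 1 \<delta> by (simp add: s_def ramp_eq_0)
    next
      case 2
      then have s: "s = u / \<delta>" using \<delta> by (simp add: s_def ramp_def)
      then have "s * u - \<delta> * s\<^sup>2 / 2 - (t * u - \<delta> * t\<^sup>2 / 2) = \<delta> * (s - t)\<^sup>2 / 2"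
      proof -
        have u: "u = \<delta> * s" using s \<delta> by simp
        show ?thesis unfolding u by (simp add: power2_eq_square field_simps)
      qed
      moreover have "\<delta> * (s - t)\<^sup>2 / 2 \<ge> 0" using \<delta> by simp
      ultimately show ?thesis by linarith
    next
      case 3
      then have s: "s = 1" using \<delta> by (simp add: s_def ramp_eq_1)
      have "s * u - \<delta> * s\<^sup>2 / 2 - (t * u - \<delta> * t\<^sup>2 / 2) = (1 - t) * (u - \<delta>) + \<delta> * (1 - t)\<^sup>2 / 2"
        by (simp add: s power2_eq_square field_simps)
      moreover have "\<dots> \<ge> 0" using \<delta> t 3 by simp
      ultimately show ?thesis by linarith
    qed
  qed
  have "(t - s) * (v - u) \<le> \<bar>t - s\<bar> * \<bar>v - u\<bar>" by (metis abs_ge_self abs_mult)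
  also have "\<dots> \<le> \<bar>v - u\<bar> / \<delta> * \<bar>v - u\<bar>"
    using ramp_lipschitz[OF \<delta>, of v u] by (intro mult_right_mono) (auto simp: s_def t_def)
  also have "\<dots> = (v - u)\<^sup>2 / \<delta>" by (simp add: power2_eq_square abs_mult[symmetric])
  finally have "(t - s) * (v - u) \<le> (v - u)\<^sup>2 / \<delta>" .
  moreover have "ramp_integral \<delta> v - ramp_integral \<delta> u \<le> t * (v - u)"
    using opt by (simp add: ramp_integral_def s_def t_def algebra_simps)
  ultimately show ?thesis by (simp add: s_def algebra_simps)
qed

lemma abs_ramp_integral_le:
  assumes "\<delta> > 0"
  shows "\<bar>ramp_integral \<delta> u\<bar> \<le> \<bar>u\<bar> + \<delta>"
proof -
  have "\<bar>ramp \<delta> u * u\<bar> \<le> 1 * \<bar>u\<bar>"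
    unfolding abs_mult using ramp_nonneg[of \<delta> u] ramp_le_1[of \<delta> u] by (intro mult_right_mono) auto
  moreover have "(ramp \<delta> u)\<^sup>2 \<le> 1" "0 \<le> (ramp \<delta> u)\<^sup>2"
    using ramp_nonneg[of \<delta> u] ramp_le_1[of \<delta> u] by (auto simp: power_le_one)
  then have "\<delta> * (ramp \<delta> u)\<^sup>2 \<le> \<delta> * 1" "0 \<le> \<delta> * (ramp \<delta> u)\<^sup>2"
    using assms by (auto intro!: mult_left_mono)
  ultimately show ?thesis using assms unfolding ramp_integral_def by linarith
qed

text \<open>The fluid drift of the smoothed excess \<open>s - \<sigma>\<close>, with \<open>a\<close> as the arrival rate per queue that is
  not idle. The drift is linear in \<open>s\<close>; its \<open>\<sigma>\<close> part vanishes because \<open>\<sigma>\<close> is an equilibrium. In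
  the \<open>u = s - \<sigma>\<close> part, summation by parts attaches to each \<open>u j\<close> the differences of the weight at
  \<open>j\<close> and the weights of its neighbours, so each term is at most \<open>\<delta>\<close> by \<open>ramp_gain_le\<close>. The left
  boundary term supplies \<open>- max 0 (u 1)\<close>; the cut at level \<open>K\<close> costs \<open>s (K + 1)\<close>.\<close>
lemma profile_drift:
  fixes s \<sigma> \<phi> :: "nat \<Rightarrow> real"
  assumes \<delta>: "\<delta> > 0" and a: "0 \<le> a" "a \<le> 1" and K: "K \<ge> 1"
    and \<sigma>: "\<And>j. j \<ge> 1 \<Longrightarrow> \<sigma> (j + 1) = a * \<sigma> j" "\<And>j. \<sigma> j \<ge> 0"
    and \<phi>: "\<And>j. 1 \<le> j \<Longrightarrow> j \<le> K \<Longrightarrow> \<phi> j = ramp \<delta> (s j - \<sigma> j)" "\<phi> 0 = 0" "\<phi> (K + 1) = 0"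
    and s: "s (K + 1) \<ge> 0"
  shows "\<sigma> 1 * \<phi> 1 + a * (\<Sum>j=1..K. s j * (\<phi> (j + 1) - \<phi> j)) -
      (\<Sum>j=1..K+1. s j * (\<phi> j - \<phi> (j - 1)))
    \<le> 2 * real K * \<delta> + s (K + 1) - max 0 (s 1 - \<sigma> 1)"
proof -
  define u where "u j = s j - \<sigma> j" for j
  have \<phi>01: "0 \<le> \<phi> j" "\<phi> j \<le> 1" if "j \<le> K + 1" for j
  proof -
    have "j = 0 \<or> j = K + 1 \<or> 1 \<le> j \<and> j \<le> K" using that by linarith
    then show "0 \<le> \<phi> j" "\<phi> j \<le> 1" using \<phi> ramp_nonneg ramp_le_1 by auto
  qed
  have gain: "u j * (t - \<phi> j) \<le> \<delta>" if "1 \<le> j" "j \<le> K" "0 \<le> t" "t \<le> 1" for j t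
    using ramp_gain_le[OF \<delta> that(3,4), of "u j"] \<phi>(1)[OF that(1,2)] by (simp add: u_def)
  have split_last: "(\<Sum>j=1..K+1. f j) = (\<Sum>j=1..K. f j) + f (K + 1)" for f :: "nat \<Rightarrow> real" by simp
  have "(\<Sum>j=1..K+1. \<sigma> j * (\<phi> j - \<phi> (j - 1))) = \<sigma> 1 * \<phi> 1 + (\<Sum>j=1..K. \<sigma> (j + 1) * (\<phi> (j + 1) - \<phi> j))"
    using \<phi>(2) sum.atLeast_Suc_atMost[of 1 "K + 1" "\<lambda>j. \<sigma> j * (\<phi> j - \<phi> (j - 1))"]
      sum.shift_bounds_cl_Suc_ivl[of "\<lambda>j. \<sigma> j * (\<phi> j - \<phi> (j - 1))" 1 K] by simp
  also have "(\<Sum>j=1..K. \<sigma> (j + 1) * (\<phi> (j + 1) - \<phi> j)) = a * (\<Sum>j=1..K. \<sigma> j * (\<phi> (j + 1) - \<phi> j))"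
    using \<sigma>(1) by (simp add: sum_distrib_left mult.assoc)
  finally have equilibrium: "\<sigma> 1 * \<phi> 1 + a * (\<Sum>j=1..K. \<sigma> j * (\<phi> (j + 1) - \<phi> j)) -
      (\<Sum>j=1..K+1. \<sigma> j * (\<phi> j - \<phi> (j - 1))) = 0" by simp
  have s_eq: "s j * x = \<sigma> j * x + u j * x" for j x by (simp add: u_def algebra_simps)
  have "\<sigma> 1 * \<phi> 1 + a * (\<Sum>j=1..K. s j * (\<phi> (j + 1) - \<phi> j)) - (\<Sum>j=1..K+1. s j * (\<phi> j - \<phi> (j - 1)))
    = a * (\<Sum>j=1..K. u j * (\<phi> (j + 1) - \<phi> j)) - (\<Sum>j=1..K+1. u j * (\<phi> j - \<phi> (j - 1)))"
    unfolding s_eq sum.distrib using equilibrium by (simp add: distrib_left)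
  also have "\<dots> = a * (\<Sum>j=1..K. u j * (\<phi> (j + 1) - \<phi> j)) + (\<Sum>j=1..K. u j * (\<phi> (j - 1) - \<phi> j)) + u (K + 1) * \<phi> K"
    unfolding split_last using \<phi>(3) by (simp add: algebra_simps sum_subtractf)
  also have "a * (\<Sum>j=1..K. u j * (\<phi> (j + 1) - \<phi> j)) \<le> real K * \<delta>"
  proof -
    have "(\<Sum>j=1..K. u j * (\<phi> (j + 1) - \<phi> j)) \<le> (\<Sum>j=1..K. \<delta>)"
      using gain \<phi>01 by (intro sum_mono) auto
    then have "a * (\<Sum>j=1..K. u j * (\<phi> (j + 1) - \<phi> j)) \<le> a * (real K * \<delta>)"
      using a by (intro mult_left_mono) auto
    also have "\<dots> \<le> 1 * (real K * \<delta>)" using a \<delta> by (intro mult_right_mono) auto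
    finally show ?thesis by simp
  qed
  also have "(\<Sum>j=1..K. u j * (\<phi> (j - 1) - \<phi> j)) \<le> (\<Sum>j=1..K. \<delta> - (if j = 1 then max 0 (u 1) else 0))"
  proof (rule sum_mono)
    fix j assume j: "j \<in> {1..K}"
    show "u j * (\<phi> (j - 1) - \<phi> j) \<le> \<delta> - (if j = 1 then max 0 (u 1) else 0)"
    proof (cases "j = 1")
      case True
      then show ?thesis
        using gain[of 1 0] gain[of 1 1] j \<phi>(2) by (auto simp: max_def algebra_simps)
    next
      case False
      then show ?thesis using gain[of j "\<phi> (j - 1)"] j \<phi>01[of "j - 1"] by auto
    qed
  qed
  also have "\<dots> = real K * \<delta> - max 0 (u 1)"
    using K by (simp add: sum_subtractf sum.delta)
  also have "u (K + 1) * \<phi> K \<le> s (K + 1)"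
  proof -
    have "u (K + 1) * \<phi> K \<le> s (K + 1) * \<phi> K"
      using \<sigma>(2)[of "K + 1"] \<phi>01[of K] by (intro mult_right_mono) (auto simp: u_def)
    also have "\<dots> \<le> s (K + 1) * 1" using s \<phi>01[of K] by (intro mult_left_mono) auto
    finally show ?thesis by simp
  qed
  finally show ?thesis unfolding u_def by (simp add: mult.commute mult.left_commute)
qed

section \<open>Fractions of long queues\<close>

definition tail_fraction :: "nat list \<Rightarrow> nat \<Rightarrow> real" where
  "tail_fraction q j = queue_mean q (\<lambda>k. of_bool (k \<ge> j))"

lemma tail_fraction_1: "tail_fraction q 1 = busy_fraction q"
  by (simp add: tail_fraction_def busy_fraction_def Suc_le_eq)

lemma tail_fraction_nonneg: "0 \<le> tail_fraction q j"
  by (simp add: tail_fraction_def queue_mean_nonneg)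

lemma tail_fraction_le_1: "tail_fraction q j \<le> 1"
proof (cases "length q = 0")
  case False
  then have "tail_fraction q j \<le> queue_mean q (\<lambda>k. 1)"
    unfolding tail_fraction_def by (intro queue_mean_mono) auto
  then show ?thesis using False by (simp add: queue_mean_const)
qed (simp add: tail_fraction_def queue_mean_def)

lemma queue_mean_by_tails:
  assumes q: "length q > 0" and g: "\<And>k. k \<ge> N \<Longrightarrow> g k = g N"
  shows "queue_mean q g = g 0 + (\<Sum>j=1..N. tail_fraction q j * (g j - g (j - 1)))"
proof -
  have "(\<Sum>j=1..M. (g j - g (j - 1)) * of_bool (k \<ge> j)) = g (min M k) - g 0" for k M
  proof (induction M)
    case (Suc M)
    show ?case
    proof (cases "Suc M \<le> k")
      case False
      then have "min (Suc M) k = min M k" by auto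
      then show ?thesis using Suc False by simp
    qed (use Suc in \<open>simp add: min_absorb1\<close>)
  qed simp
  then have "g k = g 0 + (\<Sum>j=1..N. (g j - g (j - 1)) * of_bool (k \<ge> j))" for k
    using g[of k] by (auto simp: min_def)
  then have "queue_mean q g = queue_mean q (\<lambda>k. g 0 + (\<Sum>j=1..N. (g j - g (j - 1)) * of_bool (k \<ge> j)))"
    by (intro arg_cong[where f = "queue_mean q"]) (rule ext)
  also have "\<dots> = g 0 + (\<Sum>j=1..N. tail_fraction q j * (g j - g (j - 1)))"
    unfolding queue_mean_add queue_mean_sum queue_mean_cmult queue_mean_const[OF q] tail_fraction_def
    by (simp add: mult.commute)
  finally show ?thesis .
qed

lemma tail_fraction_markov: "real j * tail_fraction q j \<le> queue_mean q real"
  unfolding tail_fraction_def queue_mean_cmult[symmetric]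
  by (intro queue_mean_mono) (auto simp: of_bool_def)

section \<open>Concentration of the busy fraction\<close>

text \<open>The derivative of the excess with respect to the fraction at level \<open>j\<close>. It is zero at level \<open>0\<close>,
  where the fraction is constant, and above the cut at \<open>K\<close>, so that sums over queues need no case
  distinction.\<close>
definition level_weight :: "real \<Rightarrow> (nat \<Rightarrow> real) \<Rightarrow> nat \<Rightarrow> nat list \<Rightarrow> nat \<Rightarrow> real" where
  "level_weight \<delta> \<sigma> K q j = (if 1 \<le> j \<and> j \<le> K then ramp \<delta> (tail_fraction q j - \<sigma> j) else 0)"

definition excess :: "real \<Rightarrow> (nat \<Rightarrow> real) \<Rightarrow> nat \<Rightarrow> nat list \<Rightarrow> real" where
  "excess \<delta> \<sigma> K q = (\<Sum>j=1..K. ramp_integral \<delta> (tail_fraction q j - \<sigma> j))"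

text \<open>The difference that the lack of a token makes to the drift of the excess, for arrivals at rate
  one: the arrival then joins a queue chosen at random instead of an empty one.\<close>
definition arrival_effect :: "real \<Rightarrow> (nat \<Rightarrow> real) \<Rightarrow> nat \<Rightarrow> nat list \<Rightarrow> real" where
  "arrival_effect \<delta> \<sigma> K q =
     queue_mean q (\<lambda>k. level_weight \<delta> \<sigma> K q (k + 1)) - level_weight \<delta> \<sigma> K q 1"

lemma level_weight_nonneg: "0 \<le> level_weight \<delta> \<sigma> K q j"
  and level_weight_le_1: "level_weight \<delta> \<sigma> K q j \<le> 1"
  by (auto simp: level_weight_def ramp_nonneg ramp_le_1)

lemma tail_fraction_update:
  assumes "i < length q"
  shows "tail_fraction (q[i := v]) j = tail_fraction q j + (of_bool (v \<ge> j) - of_bool (q ! i \<ge> j)) / real (length q)"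
  using assms by (simp add: tail_fraction_def queue_mean_update)

lemma excess_arrival:
  assumes i: "i < length q" and \<delta>: "\<delta> > 0"
  shows "excess \<delta> \<sigma> K (q[i := q ! i + 1]) - excess \<delta> \<sigma> K q
    \<le> level_weight \<delta> \<sigma> K q (q ! i + 1) / real (length q) + 1 / (\<delta> * (real (length q))\<^sup>2)"
proof -
  let ?n = "real (length q)" and ?u = "\<lambda>j. tail_fraction q j - \<sigma> j"
  let ?B = "\<lambda>j. ramp \<delta> (?u j) / ?n + 1 / (\<delta> * ?n\<^sup>2)"
  have "excess \<delta> \<sigma> K (q[i := q ! i + 1]) - excess \<delta> \<sigma> K q =
    (\<Sum>j=1..K. ramp_integral \<delta> (tail_fraction (q[i := q ! i + 1]) j - \<sigma> j) - ramp_integral \<delta> (?u j))"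
    by (simp add: excess_def sum_subtractf)
  also have "\<dots> \<le> (\<Sum>j=1..K. if j = q ! i + 1 then ?B j else 0)"
  proof (rule sum_mono)
    fix j
    show "ramp_integral \<delta> (tail_fraction (q[i := q ! i + 1]) j - \<sigma> j) - ramp_integral \<delta> (?u j)
      \<le> (if j = q ! i + 1 then ?B j else 0)"
    proof (cases "j = q ! i + 1")
      case True
      then have eq: "tail_fraction (q[i := q ! i + 1]) j - \<sigma> j = ?u j + 1 / ?n"
        using i by (simp add: tail_fraction_update)
      show ?thesis
        unfolding eq using True ramp_integral_increment[OF \<delta>, of "?u j + 1 / ?n" "?u j"]
        by (simp add: power_divide mult.commute)
    next
      case False
      then have "tail_fraction (q[i := q ! i + 1]) j = tail_fraction q j"
        using i by (simp add: tail_fraction_update of_bool_def)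
      then show ?thesis using False by simp
    qed
  qed
  also have "\<dots> \<le> level_weight \<delta> \<sigma> K q (q ! i + 1) / ?n + 1 / (\<delta> * ?n\<^sup>2)"
    using \<delta> by (simp add: level_weight_def)
  finally show ?thesis .
qed

lemma excess_departure:
  assumes i: "i < length q" and qi: "q ! i > 0" and \<delta>: "\<delta> > 0"
  shows "excess \<delta> \<sigma> K (q[i := q ! i - 1]) - excess \<delta> \<sigma> K q
    \<le> - level_weight \<delta> \<sigma> K q (q ! i) / real (length q) + 1 / (\<delta> * (real (length q))\<^sup>2)"
proof -
  let ?n = "real (length q)" and ?u = "\<lambda>j. tail_fraction q j - \<sigma> j"
  let ?B = "\<lambda>j. - ramp \<delta> (?u j) / ?n + 1 / (\<delta> * ?n\<^sup>2)"
  have "excess \<delta> \<sigma> K (q[i := q ! i - 1]) - excess \<delta> \<sigma> K q =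
    (\<Sum>j=1..K. ramp_integral \<delta> (tail_fraction (q[i := q ! i - 1]) j - \<sigma> j) - ramp_integral \<delta> (?u j))"
    by (simp add: excess_def sum_subtractf)
  also have "\<dots> \<le> (\<Sum>j=1..K. if j = q ! i then ?B j else 0)"
  proof (rule sum_mono)
    fix j assume j: "j \<in> {1..K}"
    show "ramp_integral \<delta> (tail_fraction (q[i := q ! i - 1]) j - \<sigma> j) - ramp_integral \<delta> (?u j)
      \<le> (if j = q ! i then ?B j else 0)"
    proof (cases "j = q ! i")
      case True
      then have eq: "tail_fraction (q[i := q ! i - 1]) j - \<sigma> j = ?u j - 1 / ?n"
        using i qi by (simp add: tail_fraction_update)
      show ?thesis
        unfolding eq using True ramp_integral_increment[OF \<delta>, of "?u j - 1 / ?n" "?u j"]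
        by (simp add: power_divide mult.commute)
    next
      case False
      then have "tail_fraction (q[i := q ! i - 1]) j = tail_fraction q j"
        using i by (auto simp: tail_fraction_update of_bool_def)
      then show ?thesis using False by simp
    qed
  qed
  also have "\<dots> \<le> - level_weight \<delta> \<sigma> K q (q ! i) / ?n + 1 / (\<delta> * ?n\<^sup>2)"
    using \<delta> qi by (simp add: level_weight_def)
  finally show ?thesis .
qed

lemma abs_excess_le:
  assumes "\<delta> > 0"
  shows "\<bar>excess \<delta> \<sigma> K q\<bar> \<le> (\<Sum>j=1..K. 1 + \<bar>\<sigma> j\<bar> + \<delta>)"
proof -
  have "\<bar>excess \<delta> \<sigma> K q\<bar> \<le> (\<Sum>j=1..K. \<bar>ramp_integral \<delta> (tail_fraction q j - \<sigma> j)\<bar>)"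
    unfolding excess_def by (rule sum_abs)
  also have "\<dots> \<le> (\<Sum>j=1..K. 1 + \<bar>\<sigma> j\<bar> + \<delta>)"
  proof (rule sum_mono)
    fix j
    show "\<bar>ramp_integral \<delta> (tail_fraction q j - \<sigma> j)\<bar> \<le> 1 + \<bar>\<sigma> j\<bar> + \<delta>"
      using abs_ramp_integral_le[OF assms, of "tail_fraction q j - \<sigma> j"]
        tail_fraction_nonneg[of q j] tail_fraction_le_1[of q j] by linarith
  qed
  finally show ?thesis .
qed

lemma queue_mean_level_weight_bounds:
  assumes "length q > 0"
  shows "0 \<le> queue_mean q (\<lambda>k. level_weight \<delta> \<sigma> K q' (f k))"
    and "queue_mean q (\<lambda>k. level_weight \<delta> \<sigma> K q' (f k)) \<le> 1"
proof -
  show "0 \<le> queue_mean q (\<lambda>k. level_weight \<delta> \<sigma> K q' (f k))"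
    by (intro queue_mean_nonneg level_weight_nonneg)
  have "queue_mean q (\<lambda>k. level_weight \<delta> \<sigma> K q' (f k)) \<le> queue_mean q (\<lambda>k. 1)"
    by (intro queue_mean_mono level_weight_le_1)
  then show "queue_mean q (\<lambda>k. level_weight \<delta> \<sigma> K q' (f k)) \<le> 1"
    using assms by (simp add: queue_mean_const)
qed

lemma abs_arrival_effect_le:
  assumes "length q > 0"
  shows "\<bar>arrival_effect \<delta> \<sigma> K q\<bar> \<le> 1"
  using queue_mean_level_weight_bounds[OF assms, of \<delta> \<sigma> K q "\<lambda>k. k + 1"]
    level_weight_nonneg[of \<delta> \<sigma> K q 1] level_weight_le_1[of \<delta> \<sigma> K q 1]
  unfolding arrival_effect_def by linarith

text \<open>Cooperativity. If \<open>b\<close> exceeds its equilibrium value clearly, then level \<open>1\<close> has full weight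
  and an arrival raises the excess at a random queue no more than at an empty one; if \<open>b\<close> is below it, then
  level \<open>1\<close> has weight zero and only the random queue can raise the excess. This sign is what
  \<open>token_averaging\<close> needs.\<close>
lemma busy_fraction_times_arrival_effect_le:
  assumes q: "length q > 0" and \<delta>: "\<delta> > 0" and K: "K \<ge> 1"
  shows "(busy_fraction q - \<sigma> 1) * arrival_effect \<delta> \<sigma> K q \<le> \<delta>"
proof -
  let ?u = "busy_fraction q - \<sigma> 1" and ?m = "queue_mean q (\<lambda>k. level_weight \<delta> \<sigma> K q (k + 1))"
  have "level_weight \<delta> \<sigma> K q 1 = ramp \<delta> ?u"
    using K by (simp add: level_weight_def tail_fraction_1[simplified])
  then have "?u * arrival_effect \<delta> \<sigma> K q = ?u * (?m - ramp \<delta> ?u)"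
    by (simp add: arrival_effect_def)
  also have "\<dots> \<le> \<delta>"
    using queue_mean_level_weight_bounds[OF q] by (intro ramp_gain_le[OF \<delta>])
  finally show ?thesis .
qed

lemma arrival_effect_lipschitz:
  assumes i: "i < length q" and \<delta>: "\<delta> > 0"
  shows "\<bar>arrival_effect \<delta> \<sigma> K (q[i := v]) - arrival_effect \<delta> \<sigma> K q\<bar> \<le> (1 + 2 / \<delta>) / real (length q)"
proof -
  let ?q = "q[i := v]" and ?n = "real (length q)"
  let ?w = "level_weight \<delta> \<sigma> K"
  have n: "?n > 0" using i by (cases q) auto
  have w: "\<bar>?w ?q j - ?w q j\<bar> \<le> 1 / (\<delta> * ?n)" for j
  proof (cases "1 \<le> j \<and> j \<le> K")
    case True
    have "\<bar>?w ?q j - ?w q j\<bar> \<le> \<bar>tail_fraction ?q j - tail_fraction q j\<bar> / \<delta>"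
      using ramp_lipschitz[OF \<delta>, of "tail_fraction ?q j - \<sigma> j" "tail_fraction q j - \<sigma> j"] True
      by (simp add: level_weight_def)
    also have "\<dots> \<le> (1 / ?n) / \<delta>"
      using i n \<delta> by (intro divide_right_mono) (auto simp: tail_fraction_update of_bool_def)
    finally show ?thesis by (simp add: mult.commute)
  next
    case False
    then show ?thesis using \<delta> n by (auto simp: level_weight_def)
  qed
  have "queue_mean ?q (\<lambda>k. ?w ?q (k + 1)) - queue_mean ?q (\<lambda>k. ?w q (k + 1)) =
      queue_mean ?q (\<lambda>k. ?w ?q (k + 1) - ?w q (k + 1))"
    by (rule queue_mean_diff[symmetric])
  moreover have "\<dots> \<le> queue_mean ?q (\<lambda>k. 1 / (\<delta> * ?n))"
    "queue_mean ?q (\<lambda>k. - (1 / (\<delta> * ?n))) \<le> \<dots>"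
    using w by (intro queue_mean_mono; simp add: abs_le_iff; smt (verit))+
  ultimately have 1: "\<bar>queue_mean ?q (\<lambda>k. ?w ?q (k + 1)) - queue_mean ?q (\<lambda>k. ?w q (k + 1))\<bar> \<le> 1 / (\<delta> * ?n)"
    using n by (simp add: queue_mean_const abs_le_iff)
  have "queue_mean ?q (\<lambda>k. ?w q (k + 1)) - queue_mean q (\<lambda>k. ?w q (k + 1)) =
      (?w q (v + 1) - ?w q (q ! i + 1)) / ?n"
    using i by (simp add: queue_mean_update)
  also have "\<bar>\<dots>\<bar> \<le> 1 / ?n"
  proof -
    have "\<bar>?w q (v + 1) - ?w q (q ! i + 1)\<bar> \<le> 1"
      using level_weight_nonneg[of \<delta> \<sigma> K q "v + 1"] level_weight_le_1[of \<delta> \<sigma> K q "v + 1"]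
        level_weight_nonneg[of \<delta> \<sigma> K q "q ! i + 1"] level_weight_le_1[of \<delta> \<sigma> K q "q ! i + 1"]
      by linarith
    then show ?thesis using n by (simp add: abs_divide divide_right_mono)
  qed
  finally have 2: "\<bar>queue_mean ?q (\<lambda>k. ?w q (k + 1)) - queue_mean q (\<lambda>k. ?w q (k + 1))\<bar> \<le> 1 / ?n" .
  have "\<bar>arrival_effect \<delta> \<sigma> K ?q - arrival_effect \<delta> \<sigma> K q\<bar> \<le> 1 / (\<delta> * ?n) + 1 / ?n + 1 / (\<delta> * ?n)"
    using 1 2 w[of 1] unfolding arrival_effect_def by linarith
  also have "\<dots> = (1 + 2 / \<delta>) / ?n"
    using n \<delta> by (simp add: field_simps)
  finally show ?thesis .
qed

context rcpb_steady_state
begin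

text \<open>The last term collects the second-order errors \<open>1 / (\<delta> * n\<^sup>2)\<close> of at most \<open>(lam + 1) * n\<close>
  moves per unit time.\<close>
lemma generator_excess_le:
  assumes x: "(q, m) \<in> rcpb_states n c" and \<delta>: "\<delta> > 0"
  shows "generator (\<lambda>(q, m). excess \<delta> \<sigma> K q) (q, m) \<le>
    lam * level_weight \<delta> \<sigma> K q 1 + lam * (arrival_effect \<delta> \<sigma> K q * of_bool (m = 0)) -
    queue_mean q (level_weight \<delta> \<sigma> K q) + (lam + 1) / (\<delta> * real n)"
proof -
  have q: "length q = n" "m \<le> idle_servers q" using x by (auto simp: rcpb_states_def)
  let ?w = "level_weight \<delta> \<sigma> K q" and ?e = "1 / (\<delta> * (real n)\<^sup>2)"
  have n: "real n > 0" using n_pos by simp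
  have e: "real n * ?e = 1 / (\<delta> * real n)" using n \<delta> by (simp add: power2_eq_square field_simps)
  have e0: "?e \<ge> 0" using \<delta> by simp
  have arr0: "arrival_rate lam q m i \<ge> 0" for i using lam by (simp add: arrival_rate_def)
  have "(\<Sum>i<n. arrival_rate lam q m i * (excess \<delta> \<sigma> K (q[i := q ! i + 1]) - excess \<delta> \<sigma> K q)) \<le>
    (\<Sum>i<n. arrival_rate lam q m i * (?w (q ! i + 1) / real n + ?e))"
    using excess_arrival[of _ q \<delta> \<sigma> K] q \<delta> arr0 by (intro sum_mono mult_left_mono) auto
  also have "\<dots> = (\<Sum>i<n. arrival_rate lam q m i * ?w (q ! i + 1)) / real n + (\<Sum>i<n. arrival_rate lam q m i) * ?e"
    by (simp add: distrib_left sum.distrib sum_divide_distrib sum_distrib_right)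
  also have "\<dots> = lam * (if m = 0 then queue_mean q (\<lambda>k. ?w (k + 1)) else ?w 1) + lam * (real n * ?e)"
    using sum_arrival_rate_mult[OF q(1) n_pos q(2), of lam "\<lambda>k. ?w (k + 1)"] sum_arrival_rate[OF q, of lam] n
    by simp
  also have "\<dots> = lam * ?w 1 + lam * (arrival_effect \<delta> \<sigma> K q * of_bool (m = 0)) + lam * (1 / (\<delta> * real n))"
    unfolding e by (simp add: arrival_effect_def algebra_simps)
  finally have arr: "(\<Sum>i<n. arrival_rate lam q m i * (excess \<delta> \<sigma> K (q[i := q ! i + 1]) - excess \<delta> \<sigma> K q))
    \<le> lam * ?w 1 + lam * (arrival_effect \<delta> \<sigma> K q * of_bool (m = 0)) + lam * (1 / (\<delta> * real n))" .
  have "(\<Sum>i<n. of_bool (q ! i > 0) * (excess \<delta> \<sigma> K (q[i := q ! i - 1]) - excess \<delta> \<sigma> K q)) \<le>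
    (\<Sum>i<n. ?e - ?w (q ! i) / real n)"
  proof (rule sum_mono)
    fix i assume "i \<in> {..<n}"
    then show "of_bool (q ! i > 0) * (excess \<delta> \<sigma> K (q[i := q ! i - 1]) - excess \<delta> \<sigma> K q) \<le> ?e - ?w (q ! i) / real n"
      using excess_departure[of i q \<delta> \<sigma> K] q \<delta> e0 by (cases "q ! i = 0") (auto simp: level_weight_def)
  qed
  also have "\<dots> = 1 / (\<delta> * real n) - queue_mean q ?w"
    using e q by (simp add: sum_subtractf queue_mean_def sum_divide_distrib)
  finally have dep: "(\<Sum>i<n. of_bool (q ! i > 0) * (excess \<delta> \<sigma> K (q[i := q ! i - 1]) - excess \<delta> \<sigma> K q))
    \<le> 1 / (\<delta> * real n) - queue_mean q ?w" .
  show ?thesis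
    unfolding generator_rcpb[OF x] prod.case using arr dep
    by (simp add: add_divide_distrib)
qed

text \<open>In the mean-zero identity for the excess, averaging replaces \<open>of_bool (m = 0)\<close> by its equilibrium
  probability \<open>1 / token_weight\<close>, so that arrivals join a given busy queue at rate
  \<open>a = lam / token_weight\<close>; the resulting drift is the one of \<open>profile_drift\<close>, with \<open>\<sigma>\<close> as the
  equilibrium of this rate. Markov's inequality bounds the cost of the cut at level \<open>K\<close>.\<close>
lemma busy_fraction_excess_le:
  assumes \<delta>: "\<delta> > 0" and K: "K \<ge> 1"
  shows "E (\<lambda>(q, m). max 0 (busy_fraction q - lam)) \<le>
    2 * real K * \<delta> + second_moment_bound lam / (real K + 1) +
    (real c + 1) * ((lam + 1) * ((1 + 2 / \<delta>) / real n) + \<mu> * real c / real n + \<mu> * \<delta>) +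
    (lam + 1) / (\<delta> * real n)"
proof -
  define a where "a = lam / token_weight"
  define \<sigma> where "\<sigma> j = lam * a ^ (j - 1)" for j
  have a: "0 \<le> a" "a \<le> 1" using lam token_weight_ge_1 by (auto simp: a_def divide_le_eq)
  have \<sigma>1: "\<sigma> 1 = lam" by (simp add: \<sigma>_def)
  have \<sigma>: "\<sigma> (j + 1) = a * \<sigma> j" if "j \<ge> 1" for j
    using that by (cases j) (auto simp: \<sigma>_def)
  have \<sigma>0: "\<sigma> j \<ge> 0" for j using lam a by (simp add: \<sigma>_def)
  let ?w = "level_weight \<delta> \<sigma> K" and ?T = "arrival_effect \<delta> \<sigma> K"
  let ?F = "\<lambda>(q, m). lam * ?w q 1 - queue_mean q (?w q)"
  let ?R = "(lam + 1) / (\<delta> * real n)"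
  let ?G = "generator (\<lambda>(q, m). excess \<delta> \<sigma> K q)"
  define \<eta> where "\<eta> = ((lam + 1) * ((1 + 2 / \<delta>) / real n) + \<mu> * real c / real n * E (\<lambda>(q, m). \<bar>?T q\<bar>) + \<mu> * \<delta>) / lam"
  have intT: "integrable (measure_pmf p) (\<lambda>(q, m). ?T q)"
    by (rule integrable_pmf_bounded[where B = 1]) (auto dest: set_pmf_rcpb(5) simp: abs_arrival_effect_le)
  have intTz: "integrable (measure_pmf p) (\<lambda>(q, m). ?T q * of_bool (m = 0))"
    by (rule integrable_pmf_bounded[where B = 1])
      (auto dest: set_pmf_rcpb(5) simp: abs_arrival_effect_le abs_mult of_bool_def)
  have intF: "integrable (measure_pmf p) ?F"
  proof (rule integrable_pmf_bounded[where B = 2])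
    fix x assume x: "x \<in> set_pmf p"
    obtain q m where qm: "x = (q, m)" by force
    have "\<bar>lam * ?w q 1\<bar> \<le> 1 * 1"
      unfolding abs_mult using lam level_weight_nonneg[of \<delta> \<sigma> K q 1] level_weight_le_1[of \<delta> \<sigma> K q 1]
      by (intro mult_mono) auto
    then show "\<bar>?F x\<bar> \<le> 2"
      using queue_mean_level_weight_bounds[OF set_pmf_rcpb(5)[OF x[unfolded qm]], of \<delta> \<sigma> K q "\<lambda>k. k"]
      unfolding qm prod.case by linarith
  qed
  have ET: "E (\<lambda>(q, m). \<bar>?T q\<bar>) \<le> 1"
  proof -
    have "E (\<lambda>(q, m). \<bar>?T q\<bar>) \<le> E (\<lambda>_. 1)"
      using integrable_abs[OF intT]
      by (intro expectation_mono_pmf) (auto dest: set_pmf_rcpb(5) simp: abs_arrival_effect_le case_prod_unfold)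
    then show ?thesis by simp
  qed
  have "E ?G = 0"
    using abs_excess_le[OF \<delta>, of \<sigma> K] by (intro expectation_generator_bounded) (auto simp del: sum.cl_ivl_Suc)
  moreover have "E ?G \<le> E (\<lambda>x. ?F x + lam * (case x of (q, m) \<Rightarrow> ?T q * of_bool (m = 0)) + ?R)"
  proof (rule expectation_mono_pmf)
    show "integrable (measure_pmf p) ?G"
    proof (rule expectation_generator[where w = "\<lambda>_. 2 * (\<Sum>j=1..K. 1 + \<bar>\<sigma> j\<bar> + \<delta>)"])
      fix x y :: rcpb_state
      show "\<bar>(case y of (q, m) \<Rightarrow> excess \<delta> \<sigma> K q) - (case x of (q, m) \<Rightarrow> excess \<delta> \<sigma> K q)\<bar>
        \<le> 2 * (\<Sum>j=1..K. 1 + \<bar>\<sigma> j\<bar> + \<delta>)"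
        using abs_excess_le[OF \<delta>, of \<sigma> K "fst x"] abs_excess_le[OF \<delta>, of \<sigma> K "fst y"]
        unfolding case_prod_unfold by linarith
    qed simp
    show "integrable (measure_pmf p) (\<lambda>x. ?F x + lam * (case x of (q, m) \<Rightarrow> ?T q * of_bool (m = 0)) + ?R)"
      using intF intTz by simp
    fix x assume x: "x \<in> set_pmf p"
    obtain q m where qm: "x = (q, m)" by force
    show "?G x \<le> ?F x + lam * (case x of (q, m) \<Rightarrow> ?T q * of_bool (m = 0)) + ?R"
      using generator_excess_le[OF set_pmf_rcpb(1)[OF x[unfolded qm]] \<delta>, of \<sigma> K] unfolding qm prod.case by linarith
  qed
  ultimately have 1: "0 \<le> E ?F + lam * E (\<lambda>(q, m). ?T q * of_bool (m = 0)) + ?R"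
    using intF intTz by simp
  have lip: "\<bar>?T (q[i := v]) - ?T q\<bar> \<le> (1 + 2 / \<delta>) / real n" if "length q = n" "i < n" for q i v
    using arrival_effect_lipschitz[of i q \<delta> \<sigma> K v] that \<delta> by simp
  have "(busy_fraction q - lam) * ?T q \<le> \<delta>" if "(q, m) \<in> set_pmf p" for q m
    using busy_fraction_times_arrival_effect_le[OF set_pmf_rcpb(5)[OF that] \<delta> K, of \<sigma>] \<sigma>1 by simp
  from token_averaging[where w = "\<lambda>_. \<delta>", OF intT lip lip _ _ this]
  have "token_weight * (E (\<lambda>(q, m). ?T q * of_bool (m = 0)) - (real c + 1) * \<eta>) \<le> E (\<lambda>(q, m). ?T q)"
    unfolding \<eta>_def using \<delta> by (simp add: case_prod_unfold)
  then have "(E (\<lambda>(q, m). ?T q * of_bool (m = 0)) - (real c + 1) * \<eta>) \<le> E (\<lambda>(q, m). ?T q) / token_weight"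
    using token_weight_ge_1 by (simp add: le_divide_eq mult.commute)
  then have "lam * (E (\<lambda>(q, m). ?T q * of_bool (m = 0)) - (real c + 1) * \<eta>) \<le> lam * (E (\<lambda>(q, m). ?T q) / token_weight)"
    using lam by (intro mult_left_mono) auto
  then have 2: "lam * E (\<lambda>(q, m). ?T q * of_bool (m = 0)) \<le> a * E (\<lambda>(q, m). ?T q) + (real c + 1) * (lam * \<eta>)"
    by (simp add: a_def algebra_simps)
  let ?tail = "\<lambda>(q, m). tail_fraction q (K + 1)" and ?pos = "\<lambda>(q, m). max 0 (busy_fraction q - lam)"
  have intpos: "integrable (measure_pmf p) ?pos"
    by (rule integrable_busy_fraction_excess)
  have inttail: "integrable (measure_pmf p) ?tail"
    by (rule integrable_pmf_bounded[where B = 1]) (auto simp: tail_fraction_nonneg tail_fraction_le_1)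
  have "E ?F + a * E (\<lambda>(q, m). ?T q) = E (\<lambda>x. ?F x + a * (case x of (q, m) \<Rightarrow> ?T q))"
    using intF intT by simp
  also have "\<dots> \<le> E (\<lambda>x. 2 * real K * \<delta> + ?tail x - ?pos x)"
  proof (rule expectation_mono_pmf)
    show "integrable (measure_pmf p) (\<lambda>x. ?F x + a * (case x of (q, m) \<Rightarrow> ?T q))" using intF intT by simp
    show "integrable (measure_pmf p) (\<lambda>x. 2 * real K * \<delta> + ?tail x - ?pos x)" using intpos inttail by simp
    fix x assume x: "x \<in> set_pmf p"
    obtain q m where qm: "x = (q, m)" by force
    note q = set_pmf_rcpb(5)[OF x[unfolded qm]]
    have T: "?T q = (\<Sum>j=1..K. tail_fraction q j * (?w q (j + 1) - ?w q j))"
    proof -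
      have "queue_mean q (\<lambda>k. ?w q (k + 1)) =
          ?w q (0 + 1) + (\<Sum>j=1..K. tail_fraction q j * (?w q (j + 1) - ?w q (j - 1 + 1)))"
        by (rule queue_mean_by_tails[OF q]) (simp add: level_weight_def)
      also have "(\<Sum>j=1..K. tail_fraction q j * (?w q (j + 1) - ?w q (j - 1 + 1))) =
          (\<Sum>j=1..K. tail_fraction q j * (?w q (j + 1) - ?w q j))"
        by (intro sum.cong refl) auto
      finally show ?thesis by (simp add: arrival_effect_def)
    qed
    have M: "queue_mean q (?w q) = (\<Sum>j=1..K+1. tail_fraction q j * (?w q j - ?w q (j - 1)))"
      using queue_mean_by_tails[OF q, of "K + 1" "?w q"] by (simp add: level_weight_def)
    have "\<sigma> 1 * ?w q 1 + a * (\<Sum>j=1..K. tail_fraction q j * (?w q (j + 1) - ?w q j)) -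
      (\<Sum>j=1..K+1. tail_fraction q j * (?w q j - ?w q (j - 1)))
      \<le> 2 * real K * \<delta> + tail_fraction q (K + 1) - max 0 (tail_fraction q 1 - \<sigma> 1)"
      by (rule profile_drift[where s = "tail_fraction q" and \<sigma> = \<sigma> and \<phi> = "?w q", OF \<delta> a K \<sigma> \<sigma>0]) (auto simp: level_weight_def tail_fraction_nonneg)
    then show "?F x + a * (case x of (q, m) \<Rightarrow> ?T q) \<le> 2 * real K * \<delta> + ?tail x - ?pos x"
      unfolding T[symmetric] M[symmetric] \<sigma>1 tail_fraction_1 qm prod.case by linarith
  qed
  also have "\<dots> = 2 * real K * \<delta> + E ?tail - E ?pos" using intpos inttail by simp
  finally have 3: "E ?F + a * E (\<lambda>(q, m). ?T q) \<le> 2 * real K * \<delta> + E ?tail - E ?pos" .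
  have "(real K + 1) * E ?tail = E (\<lambda>x. (real K + 1) * ?tail x)" by simp
  also have "\<dots> \<le> E (\<lambda>(q, m). queue_mean q real)"
    using inttail integrable_mean_length tail_fraction_markov[of "K + 1"]
    by (intro expectation_mono_pmf) (auto simp: add.commute)
  also have "\<dots> \<le> second_moment_bound lam" by (rule expectation_mean_length_le)
  finally have 4: "E ?tail \<le> second_moment_bound lam / (real K + 1)"
    by (simp add: le_divide_eq mult.commute)
  have "lam * \<eta> \<le> (lam + 1) * ((1 + 2 / \<delta>) / real n) + \<mu> * real c / real n + \<mu> * \<delta>"
  proof -
    have "\<mu> * real c / real n * E (\<lambda>(q, m). \<bar>?T q\<bar>) \<le> \<mu> * real c / real n * 1"
      using ET \<mu> by (intro mult_left_mono) auto
    then show ?thesis using lam by (simp add: \<eta>_def)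
  qed
  then have "(real c + 1) * (lam * \<eta>) \<le>
    (real c + 1) * ((lam + 1) * ((1 + 2 / \<delta>) / real n) + \<mu> * real c / real n + \<mu> * \<delta>)"
    by (intro mult_left_mono) auto
  with 1 2 3 4 show ?thesis by linarith
qed

end

section \<open>The asymptotic delay\<close>

lemma queue_fraction_eq_tail_fraction: "queue_fraction q i = tail_fraction q i"
proof -
  have "{j. j < length q \<and> i \<le> q ! j} = {j \<in> {..<length q}. i \<le> q ! j}" by auto
  then show ?thesis
    by (simp add: queue_fraction_def tail_fraction_def queue_mean_def of_bool_def sum.If_cases Int_def)
qed

text \<open>A queue of length \<open>k\<close> is counted once at each of the levels \<open>1, \<dots>, k\<close>.\<close>
lemma suminf_queue_fraction: "(\<Sum>i. ennreal (queue_fraction q (Suc i))) = ennreal (queue_mean q real)"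
proof -
  define N where "N = sum_list q"
  have le_N: "q ! j \<le> N" if "j < length q" for j
    using that by (auto simp: N_def intro: member_le_sum_list)
  have "queue_fraction q (Suc i) = 0" if "i \<ge> N" for i
  proof -
    have "{j. j < length q \<and> Suc i \<le> q ! j} = {}"
      using le_N that by (auto simp: not_le less_Suc_eq_le intro: order_trans)
    then show ?thesis by (simp add: queue_fraction_def)
  qed
  then have "(\<Sum>i. ennreal (queue_fraction q (Suc i))) = (\<Sum>i<N. ennreal (queue_fraction q (Suc i)))"
    by (intro suminf_finite) auto
  also have "\<dots> = ennreal (\<Sum>i<N. tail_fraction q (Suc i))"
    by (simp add: queue_fraction_eq_tail_fraction tail_fraction_nonneg sum_ennreal)
  also have "(\<Sum>i<N. tail_fraction q (Suc i)) = queue_mean q (\<lambda>k. \<Sum>i<N. of_bool (Suc i \<le> k))"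
    by (simp only: tail_fraction_def queue_mean_sum)
  also have "\<dots> = queue_mean q real"
  proof -
    have "(\<Sum>i<N. of_bool (Suc i \<le> k) :: real) = real k" if "k \<le> N" for k
    proof -
      have "{..<N} \<inter> {i. Suc i \<le> k} = {..<k}" using that by auto
      then show ?thesis by (simp add: of_bool_def sum.If_cases)
    qed
    then show ?thesis using le_N by (simp add: queue_mean_def del: sum_of_bool_eq)
  qed
  finally show ?thesis .
qed

context rcpb_steady_state
begin

lemma mean_delay_eq: "mean_delay lam p = ereal (E (\<lambda>(q, m). queue_mean q real) / lam - 1)"
proof -
  have "(\<integral>\<^sup>+ (q, m). (\<Sum>i. ennreal (queue_fraction q (Suc i))) \<partial>measure_pmf p) =
      (\<integral>\<^sup>+ x. ennreal (case x of (q, m) \<Rightarrow> queue_mean q real) \<partial>measure_pmf p)"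
    by (intro nn_integral_cong) (auto simp: suminf_queue_fraction)
  also have "\<dots> = ennreal (E (\<lambda>(q, m). queue_mean q real))"
    using integrable_mean_length by (intro nn_integral_eq_integral) (auto simp: queue_mean_nonneg)
  finally have "enn2ereal (\<integral>\<^sup>+ (q, m). (\<Sum>i. ennreal (queue_fraction q (Suc i))) \<partial>measure_pmf p) =
      ereal (E (\<lambda>(q, m). queue_mean q real))"
    by (simp add: enn2ereal_ennreal queue_mean_nonneg case_prod_unfold)
  then show ?thesis using lam by (simp add: mean_delay_def one_ereal_def)
qed

text \<open>Young's inequality separates \<open>x\<close>, with its uniformly bounded second moment, from \<open>\<bar>b - lam\<bar>\<close>,
  whose square is at most \<open>\<bar>b - lam\<bar>\<close>. Since \<open>E b = lam\<close>, the mean of \<open>\<bar>b - lam\<bar>\<close> is twice that of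
  its positive part.\<close>
lemma mean_length_times_deviation_le:
  assumes \<epsilon>: "\<epsilon> > 0"
  shows "E (\<lambda>(q, m). queue_mean q real * \<bar>busy_fraction q - lam\<bar>) \<le>
    \<epsilon> * second_moment_bound lam + E (\<lambda>(q, m). max 0 (busy_fraction q - lam)) / (2 * \<epsilon>)"
proof -
  let ?Y = "\<lambda>(q, m). queue_mean q (\<lambda>k. (real k)\<^sup>2)" and ?b = "\<lambda>(q, m). busy_fraction q"
  let ?pos = "\<lambda>(q, m). max 0 (busy_fraction q - lam)"
  have intpos: "integrable (measure_pmf p) ?pos"
    by (rule integrable_busy_fraction_excess)
  have "E (\<lambda>(q, m). queue_mean q real * \<bar>busy_fraction q - lam\<bar>) \<le>
    E (\<lambda>x. \<epsilon> * ?Y x + (2 * ?pos x - (?b x - lam)) / (4 * \<epsilon>))"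
  proof (rule expectation_mono_pmf)
    show "integrable (measure_pmf p) (\<lambda>(q, m). queue_mean q real * \<bar>busy_fraction q - lam\<bar>)"
      using abs_busy_fraction_deviation_le by (intro integrable_mean_length_times_bounded[where B = 1]) auto
    show "integrable (measure_pmf p) (\<lambda>x. \<epsilon> * ?Y x + (2 * ?pos x - (?b x - lam)) / (4 * \<epsilon>))"
      using second_moment(1) intpos integrable_busy_fraction by simp
    fix x assume x: "x \<in> set_pmf p"
    obtain q m where qm: "x = (q, m)" by force
    define l d where "l = queue_mean q real" and "d = \<bar>busy_fraction q - lam\<bar>"
    have d: "0 \<le> d" "d \<le> 1" using abs_busy_fraction_deviation_le by (auto simp: d_def)
    have jensen: "l\<^sup>2 \<le> queue_mean q (\<lambda>k. (real k)\<^sup>2)"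
    proof -
      have "0 \<le> queue_mean q (\<lambda>k. (real k - l)\<^sup>2)" by (intro queue_mean_nonneg) simp
      also have "(\<lambda>k. (real k - l)\<^sup>2) = (\<lambda>k. (real k)\<^sup>2 - (2 * l) * real k + l\<^sup>2)"
        by (simp add: fun_eq_iff power2_diff algebra_simps)
      also have "queue_mean q \<dots> = queue_mean q (\<lambda>k. (real k)\<^sup>2) - (2 * l) * l + l\<^sup>2"
        unfolding queue_mean_add queue_mean_diff queue_mean_cmult
        using queue_mean_const[OF set_pmf_rcpb(5)[OF x[unfolded qm]]] by (simp add: l_def)
      finally show ?thesis by (simp add: power2_eq_square)
    qed
    have "l * d = \<epsilon> * l\<^sup>2 + d\<^sup>2 / (4 * \<epsilon>) - (2 * \<epsilon> * l - d)\<^sup>2 / (4 * \<epsilon>)"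
      using \<epsilon> by (simp add: power2_eq_square field_simps)
    also have "\<dots> \<le> \<epsilon> * l\<^sup>2 + d\<^sup>2 / (4 * \<epsilon>)" using \<epsilon> by simp
    also have "\<dots> \<le> \<epsilon> * queue_mean q (\<lambda>k. (real k)\<^sup>2) + d / (4 * \<epsilon>)"
      using jensen \<epsilon> d by (intro add_mono mult_left_mono divide_right_mono) (auto simp: power2_eq_square mult_left_le)
    also have "d / (4 * \<epsilon>) = (2 * ?pos x - (?b x - lam)) / (4 * \<epsilon>)" by (auto simp: d_def qm max_def)
    finally show "(case x of (q, m) \<Rightarrow> queue_mean q real * \<bar>busy_fraction q - lam\<bar>) \<le>
       \<epsilon> * ?Y x + (2 * ?pos x - (?b x - lam)) / (4 * \<epsilon>)"
      by (simp add: qm l_def d_def)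
  qed
  also have "\<dots> = \<epsilon> * E ?Y + (2 * E ?pos - (E ?b - lam)) / (4 * \<epsilon>)"
    using second_moment(1) intpos integrable_busy_fraction by simp
  also have "\<dots> = \<epsilon> * E ?Y + E ?pos / (2 * \<epsilon>)" by (simp add: expectation_busy_fraction)
  also have "\<dots> \<le> \<epsilon> * second_moment_bound lam + E ?pos / (2 * \<epsilon>)"
    using second_moment(2) \<epsilon> by simp
  finally show ?thesis .
qed

end

lemma busy_fraction_excess_tendsto_0:
  assumes ss: "\<And>n. n \<ge> c \<Longrightarrow> rcpb_steady_state lam \<mu> n c (p n)"
  shows "(\<lambda>n. measure_pmf.expectation (p n) (\<lambda>(q, m). max 0 (busy_fraction q - lam))) \<longlonglongrightarrow> 0"
    (is "?\<beta> \<longlonglongrightarrow> 0")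
proof (rule order_tendstoI)
  have "?\<beta> n \<ge> 0" for n by (intro integral_nonneg_AE) auto
  then show "\<forall>\<^sub>F n in sequentially. r < ?\<beta> n" if "r < 0" for r
    using that by (intro always_eventually) (auto intro: less_le_trans)
next
  fix r :: real assume r: "0 < r"
  let ?C = "second_moment_bound lam"
  have \<mu>: "\<mu> > 0" using ss[OF order_refl] by (simp add: rcpb_steady_state_def)
  \<comment> \<open>Three error terms remain as \<open>n\<close> grows: the cut at level \<open>K\<close>, and two multiples of \<open>\<delta>\<close> that are
    collected in \<open>L * \<delta>\<close>. The scale \<open>\<delta>\<close> is chosen after \<open>K\<close>.\<close>
  obtain K :: nat where "max 1 (4 * ?C / r) < real K" using reals_Archimedean2 by blast
  then have K: "K \<ge> 1" "4 * ?C / r < real K + 1" by auto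
  have K': "?C / (real K + 1) < r / 4"
    using K(2) r by (simp add: field_simps)
  define L where "L = 2 * real K + (real c + 1) * \<mu>"
  have L: "L > 0" using K \<mu> by (simp add: L_def add_pos_pos)
  define \<delta> where "\<delta> = r / (4 * L)"
  have \<delta>: "\<delta> > 0" "L * \<delta> = r / 4" using r L by (auto simp: \<delta>_def)
  let ?bound = "\<lambda>n. 2 * real K * \<delta> + ?C / (real K + 1) +
    (real c + 1) * ((lam + 1) * ((1 + 2 / \<delta>) / real n) + \<mu> * real c / real n + \<mu> * \<delta>) +
    (lam + 1) / (\<delta> * real n)"
  have lim3: "(\<lambda>n. (lam + 1) / (\<delta> * real n)) \<longlonglongrightarrow> 0"
    using lim_const_over_n[of "(lam + 1) / \<delta>"] by simp
  have lim: "?bound \<longlonglongrightarrow> 2 * real K * \<delta> + ?C / (real K + 1) +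
    (real c + 1) * ((lam + 1) * 0 + 0 + \<mu> * \<delta>) + 0"
    by (intro tendsto_add tendsto_mult tendsto_const lim_const_over_n lim3)
  have "2 * real K * \<delta> + ?C / (real K + 1) + (real c + 1) * ((lam + 1) * 0 + 0 + \<mu> * \<delta>) + 0 =
      L * \<delta> + ?C / (real K + 1)"
    by (simp add: L_def algebra_simps)
  moreover have "\<dots> < r" using K' \<delta>(2) r by linarith
  ultimately have "\<forall>\<^sub>F n in sequentially. ?bound n < r"
    by (intro order_tendstoD(2)[OF lim]) simp
  moreover have "\<forall>\<^sub>F n in sequentially. ?\<beta> n \<le> ?bound n"
    using rcpb_steady_state.busy_fraction_excess_le[OF ss \<delta>(1) K(1)]
    by (auto simp: eventually_sequentially)
  ultimately show "\<forall>\<^sub>F n in sequentially. ?\<beta> n < r"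
    by eventually_elim linarith
qed

lemma mean_length_times_deviation_tendsto_0:
  assumes ss: "\<And>n. n \<ge> c \<Longrightarrow> rcpb_steady_state lam \<mu> n c (p n)"
  shows "(\<lambda>n. measure_pmf.expectation (p n) (\<lambda>(q, m). queue_mean q real * \<bar>busy_fraction q - lam\<bar>)) \<longlonglongrightarrow> 0"
    (is "?d \<longlonglongrightarrow> 0")
proof (rule order_tendstoI)
  have "?d n \<ge> 0" for n by (intro integral_nonneg_AE) (auto simp: queue_mean_nonneg)
  then show "\<forall>\<^sub>F n in sequentially. r < ?d n" if "r < 0" for r
    using that by (intro always_eventually) (auto intro: less_le_trans)
next
  fix r :: real assume r: "0 < r"
  let ?C = "second_moment_bound lam"
  let ?\<beta> = "\<lambda>n. measure_pmf.expectation (p n) (\<lambda>(q, m). max 0 (busy_fraction q - lam))"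
  have "0 < lam" "lam < 1" using ss[OF order_refl] by (auto simp: rcpb_steady_state_def)
  then have C: "?C > 0" by (simp add: second_moment_bound_def add_pos_pos)
  define \<epsilon> where "\<epsilon> = r / (2 * ?C)"
  have \<epsilon>: "\<epsilon> > 0" "\<epsilon> * ?C = r / 2" using r C by (auto simp: \<epsilon>_def)
  have lim: "(\<lambda>n. \<epsilon> * ?C + ?\<beta> n / (2 * \<epsilon>)) \<longlonglongrightarrow> \<epsilon> * ?C + 0 / (2 * \<epsilon>)"
    using \<epsilon> by (intro tendsto_intros busy_fraction_excess_tendsto_0[OF ss]) auto
  have "\<forall>\<^sub>F n in sequentially. \<epsilon> * ?C + ?\<beta> n / (2 * \<epsilon>) < r"
    by (rule order_tendstoD(2)[OF lim]) (use \<epsilon> r in simp)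
  moreover have "\<forall>\<^sub>F n in sequentially. ?d n \<le> \<epsilon> * ?C + ?\<beta> n / (2 * \<epsilon>)"
    using rcpb_steady_state.mean_length_times_deviation_le[OF ss \<epsilon>(1)]
    by (auto simp: eventually_sequentially)
  ultimately show "\<forall>\<^sub>F n in sequentially. ?d n < r"
    by eventually_elim linarith
qed

text \<open>In the limit \<open>mean_length_averaging\<close> becomes the linear equation \<open>x = D * (x - lam) / lam\<close>, whose
  solution is \<open>x = lam * D / (D - lam)\<close>; here \<open>D \<ge> 1 > lam\<close>.\<close>
lemma asymptotic_delay_eq:
  assumes lam: "0 < lam" "lam < 1" and \<alpha>: "\<alpha> > 0" and c: "c \<ge> 1"
    and stat: "\<And>n. n \<ge> c \<Longrightarrow> rcpb_stationary lam (\<alpha> / (1 - lam)) n c (p n)"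
  shows "asymptotic_delay lam p = ereal (lam / ((\<Sum>k\<le>c. (\<alpha> / lam) ^ k) - lam))"
proof -
  define \<mu> where "\<mu> = \<alpha> / (1 - lam)"
  define D where "D = (\<Sum>k\<le>c. (\<alpha> / lam) ^ k)"
  have ss: "rcpb_steady_state lam \<mu> n c (p n)" if "n \<ge> c" for n
    using lam \<alpha> c stat[OF that] that by unfold_locales (auto simp: \<mu>_def)
  have D: "rcpb_steady_state.token_weight lam \<mu> c = D" if "n \<ge> c" for n
    using lam rcpb_steady_state.token_weight_def[OF ss[OF that]] rcpb_steady_state.token_ratio_def[OF ss[OF that]]
    by (simp add: \<mu>_def D_def)
  have D1: "D \<ge> 1"
    using rcpb_steady_state.token_weight_ge_1[OF ss[OF order_refl]] D[OF order_refl] by simp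
  let ?x = "\<lambda>n. measure_pmf.expectation (p n) (\<lambda>(q, m). queue_mean q real)"
  let ?d = "\<lambda>n. measure_pmf.expectation (p n) (\<lambda>(q, m). queue_mean q real * \<bar>busy_fraction q - lam\<bar>)"
  let ?C = "second_moment_bound lam"
  let ?B = "\<lambda>n. D * (real c + 1) * (((lam + 1) / real n + \<mu> * real c / real n * ?C + \<mu> * ?d n) / lam)"
  have \<mu>: "\<mu> > 0" using lam \<alpha> by (simp add: \<mu>_def)
  have "?B \<longlonglongrightarrow> D * (real c + 1) * ((0 + 0 * ?C + \<mu> * 0) / lam)"
    using lam by (intro tendsto_intros lim_const_over_n mean_length_times_deviation_tendsto_0[OF ss]) auto
  then have B: "?B \<longlonglongrightarrow> 0" by simp
  have "\<bar>?x n - D * ((?x n - lam) / lam)\<bar> \<le> ?B n" if n: "n \<ge> c" for n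
  proof -
    have "\<bar>?x n - D * ((?x n - lam) / lam)\<bar> \<le>
      D * (real c + 1) * (((lam + 1) / real n + \<mu> * real c / real n * ?x n + \<mu> * ?d n) / lam)"
      using rcpb_steady_state.mean_length_averaging[OF ss[OF n]] D[OF n] by simp
    also have "\<dots> \<le> ?B n"
      using D1 lam \<mu> rcpb_steady_state.expectation_mean_length_le[OF ss[OF n]]
      by (intro mult_left_mono divide_right_mono add_mono order_refl) auto
    finally show ?thesis .
  qed
  then have "\<forall>\<^sub>F n in sequentially. norm (?x n - D * ((?x n - lam) / lam)) \<le> ?B n"
    by (auto simp: eventually_sequentially)
  from Lim_null_comparison[OF this B]
  have lim: "(\<lambda>n. ?x n - D * ((?x n - lam) / lam)) \<longlonglongrightarrow> 0" .
  have Dlam: "D - lam > 0" using D1 lam by simp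
  have "(\<lambda>n. (D - (?x n - D * ((?x n - lam) / lam))) / (D - lam) - 1) \<longlonglongrightarrow> (D - 0) / (D - lam) - 1"
    using Dlam by (intro tendsto_intros lim) auto
  also have "(D - 0) / (D - lam) - 1 = lam / (D - lam)" using Dlam by (simp add: field_simps)
  also have "(\<lambda>n. (D - (?x n - D * ((?x n - lam) / lam))) / (D - lam) - 1) = (\<lambda>n. ?x n / lam - 1)"
  proof
    fix n
    have "(D - (?x n - D * ((?x n - lam) / lam))) = ?x n / lam * (D - lam)"
      using lam by (simp add: field_simps)
    then show "(D - (?x n - D * ((?x n - lam) / lam))) / (D - lam) - 1 = ?x n / lam - 1"
      using Dlam by simp
  qed
  finally have "(\<lambda>n. ereal (?x n / lam - 1)) \<longlonglongrightarrow> ereal (lam / (D - lam))" by simp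
  moreover have "\<forall>\<^sub>F n in sequentially. ereal (?x n / lam - 1) = mean_delay lam (p n)"
    using eventually_ge_at_top[of c] by eventually_elim (simp add: rcpb_steady_state.mean_delay_eq[OF ss])
  ultimately have "(\<lambda>n. mean_delay lam (p n)) \<longlonglongrightarrow> ereal (lam / (D - lam))"
    by (rule Lim_transform_eventually)
  then show ?thesis
    unfolding asymptotic_delay_def D_def[symmetric] by (intro lim_imp_Limsup) auto
qed

theorem mainTheorem4:
  fixes lam \<alpha> :: real and \<pi> :: "nat \<Rightarrow> nat \<Rightarrow> rcpb_state pmf"
  assumes "0 < lam" "lam < 1" "\<alpha> > 0"
    and "\<And>c n. 1 \<le> c \<Longrightarrow> c \<le> n \<Longrightarrow> rcpb_stationary lam (\<alpha> / (1 - lam)) n c (\<pi> c n)"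
  shows "(\<alpha> < lam \<longrightarrow>
            (\<lambda>c. asymptotic_delay lam (\<pi> c)) \<longlonglongrightarrow>
              ereal (lam * (lam - \<alpha>) / ((1 - lam) * (lam - \<alpha>) + \<alpha>))) \<and>
         (\<alpha> = lam \<longrightarrow> (\<forall>c\<ge>1.
            asymptotic_delay lam (\<pi> c) = ereal (lam / (1 - lam + real c)) \<and>
            lam / (1 - lam + real c) \<le> 1 / real c)) \<and>
         (\<alpha> > lam \<longrightarrow> (\<forall>c\<ge>1.
            asymptotic_delay lam (\<pi> c) =
              ereal (lam * inverse (1 - lam + (\<Sum>k=1..c. (\<alpha> / lam) ^ k))) \<and>
            lam * inverse (1 - lam + (\<Sum>k=1..c. (\<alpha> / lam) ^ k)) \<le> (lam / \<alpha>) ^ c))"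
proof (intro conjI impI allI)
  have delay: "asymptotic_delay lam (\<pi> c) = ereal (lam / ((\<Sum>k\<le>c. (\<alpha> / lam) ^ k) - lam))" if "c \<ge> 1" for c
    using assms that by (intro asymptotic_delay_eq) auto
  {
    assume less: "\<alpha> < lam"
    let ?\<rho> = "\<alpha> / lam"
    have "(\<lambda>c. \<Sum>k\<le>c. ?\<rho> ^ k) \<longlonglongrightarrow> 1 / (1 - ?\<rho>)"
      using geometric_sums[of ?\<rho>] less assms by (simp add: sums_def_le)
    then have "(\<lambda>c. lam / ((\<Sum>k\<le>c. ?\<rho> ^ k) - lam)) \<longlonglongrightarrow> lam / (1 / (1 - ?\<rho>) - lam)"
    proof (intro tendsto_intros)
      have "1 / (1 - ?\<rho>) = lam / (lam - \<alpha>)" using assms less by (simp add: field_simps)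
      moreover have "lam / (lam - \<alpha>) > 1" using assms less by simp
      ultimately show "1 / (1 - ?\<rho>) - lam \<noteq> 0" using assms by simp
    qed auto
    also have "lam / (1 / (1 - ?\<rho>) - lam) = lam * (lam - \<alpha>) / ((1 - lam) * (lam - \<alpha>) + \<alpha>)"
    proof -
      have "1 / (1 - ?\<rho>) - lam = ((1 - lam) * (lam - \<alpha>) + \<alpha>) / (lam - \<alpha>)"
        using assms less by (simp add: field_simps)
      then show ?thesis by simp
    qed
    finally have "(\<lambda>c. ereal (lam / ((\<Sum>k\<le>c. ?\<rho> ^ k) - lam))) \<longlonglongrightarrow>
      ereal (lam * (lam - \<alpha>) / ((1 - lam) * (lam - \<alpha>) + \<alpha>))" by simp
    moreover have "\<forall>\<^sub>F c in sequentially. ereal (lam / ((\<Sum>k\<le>c. ?\<rho> ^ k) - lam)) = asymptotic_delay lam (\<pi> c)"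
      using delay by (auto simp: eventually_sequentially intro!: exI[of _ 1])
    ultimately show "(\<lambda>c. asymptotic_delay lam (\<pi> c)) \<longlonglongrightarrow>
      ereal (lam * (lam - \<alpha>) / ((1 - lam) * (lam - \<alpha>) + \<alpha>))"
      by (rule Lim_transform_eventually)
  next
    fix c :: nat assume "\<alpha> = lam" "1 \<le> c"
    then show "asymptotic_delay lam (\<pi> c) = ereal (lam / (1 - lam + real c))"
      using delay[of c] assms by (simp add: algebra_simps)
    have "lam * real c \<le> 1 * real c" using assms by (intro mult_right_mono) auto
    then have "lam + lam * real c \<le> 1 + real c" using assms by linarith
    then show "lam / (1 - lam + real c) \<le> 1 / real c"
      using assms \<open>1 \<le> c\<close> by (simp add: divide_le_eq le_divide_eq field_simps)
  next
    fix c :: nat assume gr: "\<alpha> > lam" and c: "1 \<le> c"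
    let ?s = "\<Sum>k=1..c. (\<alpha> / lam) ^ k"
    have "(\<Sum>k\<le>c. (\<alpha> / lam) ^ k) = 1 + ?s"
      by (simp add: atMost_atLeast0 sum.atLeast_Suc_atMost)
    then show "asymptotic_delay lam (\<pi> c) = ereal (lam * inverse (1 - lam + ?s))"
      using delay[OF c] by (simp add: divide_inverse algebra_simps)
    have "(\<alpha> / lam) ^ c \<le> ?s"
      using assms c by (intro member_le_sum) auto
    then have "(\<alpha> / lam) ^ c \<le> 1 - lam + ?s" using assms by linarith
    moreover have "(\<alpha> / lam) ^ c > 0" using assms by simp
    moreover from calculation have "0 \<le> 1 - lam + ?s" by linarith
    ultimately have "lam * inverse (1 - lam + ?s) \<le> 1 * inverse ((\<alpha> / lam) ^ c)"
      using assms by (intro mult_mono le_imp_inverse_le) auto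
    then show "lam * inverse (1 - lam + ?s) \<le> (lam / \<alpha>) ^ c"
      by (simp add: power_divide)
  }
qed

end
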